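(* Let $\beta_1,\dots,\beta_s\in(\mathbb C^d)^*$ be a spanning configuration of uniform maximal rank in dimension $d\ge1$, and fix $r\ge1$. For every homomorphism $\eta:\mathbb Z^r\to T_\beta$ there exists a configuration of weights in $(\mathbb C^{r+d})^*$ of uniform maximal rank in the Poincaré domain, with a singular support of cardinality $r$ whose residual weights are the $\beta_j$ and whose envelope monodromy, under the standard identification of the period group with $2\pi\sqrt{-1}\,\mathbb Z^r$, is $\eta$.
   Context: A spanning configuration $\beta_1,\dots,\beta_s\in(\mathbb C^d)^*$ has uniform maximal rank in dimension $d$ if $\dim\operatorname{Span}\{\beta_j:j\in K\}=\min\{|K|,d\}$ for every $K$. Put $S_\beta=\{\alpha\in\mathbb N^s:\sum_j\alpha_j\beta_j=0\}$ ($0\in\mathbb N$), $M_\beta=\operatorname{gp}(S_\beta)$, $Q_\beta=\operatorname{Spec}\mathbb C[S_\beta]$ and $T_\beta=\operatorname{Hom}(M_\beta,\mathbb C^* )$, which acts on $Q_\beta$ by $\theta^*X^\alpha=\theta(\alpha)X^\alpha$. For weights $\Lambda_1,\dots,\Lambda_n$ spanning $(\mathbb C^k)^*$ (of the diagonal action $t\cdot z=(e^{\Lambda_j(t)}z_j)_j$): uniform maximal rank means $\dim\operatorname{Span}\{\Lambda_i:i\in I\}=\min\{|I|,k\}$ for all $I$; Poincaré domain means some $\xi$ has $\operatorname{Re}\Lambda_j(\xi)>0$ for all $j$; $I$ is a singular support if $\dim\operatorname{Span}\{\Lambda_i:i\in I\}<k$. For $I$ put $J=I^c$, $\mathfrak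 h_I=\bigcap_{i\in I}\ker\Lambda_i$; the residual weights are $\Lambda_j|_{\mathfrak h_I}$, $j\in J$ (identified with the $\beta_j$ through an isomorphism $\mathfrak h_I\simeq\mathbb C^d$ and a labelling of $J$ by $1,\dots,s$); $V_I=\mathbb C^k/\mathfrak h_I$; the period group is $\Gamma_I=\{t:\Lambda_i(t)\in2\pi\sqrt{-1}\,\mathbb Z\ \forall i\in I\}/\mathfrak h_I\subset V_I$. If the support weights are linearly independent, $v\mapsto(\Lambda_i(v))_{i\in I}$ identifies $V_I$ with $\mathbb C^I$ and $\Gamma_I$ with $(2\pi\sqrt{-1}\,\mathbb Z)^I$ (the standard identification). For $\alpha\in M_I=\operatorname{gp}\{\alpha\in\mathbb N^J:\sum_j\alpha_j\Lambda_j|_{\mathfrak h_I}=0\}$, $\nu_\alpha=\sum_{j\in J}\alpha_j\Lambda_j\in V_I^*$, and the envelope monodromy $\rho_I$ sends $\gamma\in\Gamma_I$ to the element $\alpha\mapsto e^{\nu_\alpha(\gamma)}$ of $\operatorname{Hom}(M_I,\mathbb C^* )$, acting on $Q_I$. *)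

theory Defs
  imports "HOL-Analysis.Analysis" "HOL-Library.Function_Algebras" "HOL-Algebra.Generated_Groups"
begin

definition fscale :: "complex \<Rightarrow> ('v \<Rightarrow> complex) \<Rightarrow> 'v \<Rightarrow> complex" where
  "fscale c f = (\<lambda>v. c * f v)"

interpretation fun_space: vector_space "fscale :: complex \<Rightarrow> ('v \<Rightarrow> complex) \<Rightarrow> 'v \<Rightarrow> complex"
  by unfold_locales (auto simp: fscale_def fun_eq_iff algebra_simps)

definition dual_space :: "(complex ^ 'k \<Rightarrow> complex) set" where
  "dual_space = {f. Vector_Spaces.linear (*s) (*) f}"


text \<open>
  A configuration of weights is a family \<open>\<Lambda>\<close> of linear functionals, indexed by a finite set \<open>N\<close>;
  values of \<open>\<Lambda>\<close> outside \<open>N\<close> are irrelevant. Repetitions are allowed, so below \<open>card K\<close> counts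
  indices and not functionals.
\<close>

definition spanning_configuration :: "'i set \<Rightarrow> ('i \<Rightarrow> complex ^ 'k \<Rightarrow> complex) \<Rightarrow> bool" where
  "spanning_configuration N \<Lambda> \<longleftrightarrow>
     finite N \<and> \<Lambda> ` N \<subseteq> dual_space \<and> fun_space.span (\<Lambda> ` N) = dual_space"

definition uniform_maximal_rank :: "'i set \<Rightarrow> ('i \<Rightarrow> complex ^ 'k \<Rightarrow> complex) \<Rightarrow> bool" where
  "uniform_maximal_rank N \<Lambda> \<longleftrightarrow>
     (\<forall>K\<subseteq>N. fun_space.dim (fun_space.span (\<Lambda> ` K)) = min (card K) CARD('k))"

definition Poincare_domain :: "'i set \<Rightarrow> ('i \<Rightarrow> complex ^ 'k \<Rightarrow> complex) \<Rightarrow> bool" where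
  "Poincare_domain N \<Lambda> \<longleftrightarrow> (\<exists>\<xi>. \<forall>j\<in>N. 0 < Re (\<Lambda> j \<xi>))"

definition singular_support :: "'i set \<Rightarrow> ('i \<Rightarrow> complex ^ 'k \<Rightarrow> complex) \<Rightarrow> 'i set \<Rightarrow> bool" where
  "singular_support N \<Lambda> I \<longleftrightarrow>
     I \<subseteq> N \<and> fun_space.dim (fun_space.span (\<Lambda> ` I)) < CARD('k)"

definition isotropy :: "('i \<Rightarrow> complex ^ 'k \<Rightarrow> complex) \<Rightarrow> 'i set \<Rightarrow> (complex ^ 'k) set" where
  "isotropy \<Lambda> I = {t. \<forall>i\<in>I. \<Lambda> i t = 0}"


definition additive_group :: "'a::ab_group_add monoid" where
  "additive_group = \<lparr>carrier = UNIV, mult = (+), one = 0\<rparr>"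

definition Cstar :: "complex monoid" where
  "Cstar = \<lparr>carrier = - {0}, mult = (*), one = 1\<rparr>"

text \<open>
  The relation monoid of the functionals \<open>\<beta> j\<close>, \<open>j \<in> J\<close>, restricted to the subspace \<open>H\<close>.
  Elements of \<open>\<nat>\<^sup>J\<close> are encoded as functions on the whole index type which vanish outside \<open>J\<close>.
  The group generated by it is formed in \<open>'i \<Rightarrow> int\<close>, whose addition is pointwise.
\<close>

definition relation_monoid ::
    "(complex ^ 'k) set \<Rightarrow> 'i set \<Rightarrow> ('i \<Rightarrow> complex ^ 'k \<Rightarrow> complex) \<Rightarrow> ('i \<Rightarrow> nat) set" where
  "relation_monoid H J \<beta> =
     {\<alpha>. (\<forall>j. j \<notin> J \<longrightarrow> \<alpha> j = 0) \<and> (\<forall>v\<in>H. (\<Sum>j\<in>J. of_nat (\<alpha> j) * \<beta> j v) = 0)}"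

definition relation_lattice ::
    "(complex ^ 'k) set \<Rightarrow> 'i set \<Rightarrow> ('i \<Rightarrow> complex ^ 'k \<Rightarrow> complex) \<Rightarrow> ('i \<Rightarrow> int) set" where
  "relation_lattice H J \<beta> =
     generate additive_group ((\<lambda>\<alpha> j. int (\<alpha> j)) ` relation_monoid H J \<beta>)"

text \<open>The group \<open>Hom(M, \<complex>\<^sup>*)\<close>, for a subgroup \<open>M\<close> of an additive group.\<close>

definition character_group :: "'a::ab_group_add set \<Rightarrow> ('a \<Rightarrow> complex) monoid" where
  "character_group M =
     \<lparr>carrier = hom (additive_group\<lparr>carrier := M\<rparr>) Cstar \<inter> extensional M,
      mult = (\<lambda>\<theta> \<theta>'. \<lambda>a\<in>M. \<theta> a * \<theta>' a),
      one = (\<lambda>a\<in>M. 1)\<rparr>"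


text \<open>
  Elements of \<open>V\<^sub>I = \<complex>\<^sup>k / \<hh>\<^sub>I\<close> are cosets. A functional which vanishes on \<open>\<hh>\<^sub>I\<close> is constant on
  each coset, and this constant is the value of the functional which it induces on \<open>V\<^sub>I\<close>.
\<close>

definition quotient_eval :: "('v \<Rightarrow> 'c) \<Rightarrow> 'v set \<Rightarrow> 'c" where
  "quotient_eval f \<gamma> = the_elem (f ` \<gamma>)"

definition period_group ::
    "('i \<Rightarrow> complex ^ 'k \<Rightarrow> complex) \<Rightarrow> 'i set \<Rightarrow> (complex ^ 'k) set monoid" where
  "period_group \<Lambda> I =
     additive_group\<lparr>carrier := {t. \<forall>i\<in>I. \<exists>m::int. \<Lambda> i t = 2 * of_real pi * \<i> * of_int m}\<rparr>
       Mod isotropy \<Lambda> I"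

text \<open>
  The standard identification of the period group with \<open>(2\<pi>\<i>\<int>)\<^sup>I\<close>, written in the coordinates
  on \<open>\<int>\<^sup>r\<close> that a labelling \<open>\<tau>\<close> of \<open>I\<close> provides; the factor \<open>2\<pi>\<i>\<close> is dropped.
\<close>

definition standard_identification ::
    "('i \<Rightarrow> complex ^ 'k \<Rightarrow> complex) \<Rightarrow> ('r \<Rightarrow> 'i) \<Rightarrow> (complex ^ 'k) set \<Rightarrow> int ^ 'r" where
  "standard_identification \<Lambda> \<tau> \<gamma> =
     (\<chi> l. THE m. quotient_eval (\<Lambda> (\<tau> l)) \<gamma> = 2 * of_real pi * \<i> * of_int m)"

definition residual_lattice ::
    "'i set \<Rightarrow> ('i \<Rightarrow> complex ^ 'k \<Rightarrow> complex) \<Rightarrow> 'i set \<Rightarrow> ('i \<Rightarrow> int) set" where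
  "residual_lattice N \<Lambda> I = relation_lattice (isotropy \<Lambda> I) (N - I) \<Lambda>"

definition envelope_monodromy ::
    "'i set \<Rightarrow> ('i \<Rightarrow> complex ^ 'k \<Rightarrow> complex) \<Rightarrow> 'i set \<Rightarrow> (complex ^ 'k) set \<Rightarrow>
     ('i \<Rightarrow> int) \<Rightarrow> complex" where
  "envelope_monodromy N \<Lambda> I \<gamma> =
     (\<lambda>\<alpha>\<in>residual_lattice N \<Lambda> I.
        exp (quotient_eval (\<lambda>t. \<Sum>j\<in>N - I. of_int (\<alpha> j) * \<Lambda> j t) \<gamma>))"

text \<open>
  The residual weights are the \<open>\<beta> j\<close>, through the isomorphism \<open>\<phi>\<close> from \<open>\<complex>\<^sup>d\<close> onto \<open>\<hh>\<^sub>I\<close> and the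
  labelling \<open>\<sigma>\<close> of the complement of \<open>I\<close>.
\<close>

definition residual_weights_via ::
    "'i set \<Rightarrow> ('i \<Rightarrow> complex ^ 'k \<Rightarrow> complex) \<Rightarrow> 'i set \<Rightarrow>
     (complex ^ 'd \<Rightarrow> complex ^ 'k) \<Rightarrow> ('s \<Rightarrow> 'i) \<Rightarrow> ('s \<Rightarrow> complex ^ 'd \<Rightarrow> complex) \<Rightarrow> bool" where
  "residual_weights_via N \<Lambda> I \<phi> \<sigma> \<beta> \<longleftrightarrow>
     Vector_Spaces.linear (*s) (*s) \<phi> \<and> bij_betw \<phi> UNIV (isotropy \<Lambda> I) \<and>
     bij_betw \<sigma> UNIV (N - I) \<and>
     (\<forall>j v. \<Lambda> (\<sigma> j) (\<phi> v) = \<beta> j v)"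

end

theory Submission
  imports Defs
begin

text \<open>
  On \<open>\<complex>\<^sup>r \<oplus> \<complex>\<^sup>d\<close> take the \<open>r\<close> coordinates \<open>e\<^sub>l\<close> of the first factor as support weights and
  \<open>\<Sum>\<^sub>l C\<^sub>j\<^sub>l e\<^sub>l + \<beta>\<^sub>j\<close> as the remaining weights. Their restrictions to the isotropy \<open>\<complex>\<^sup>d\<close> are the
  \<open>\<beta>\<^sub>j\<close>, and the period \<open>2\<pi>i m\<close> has monodromy \<open>\<alpha> \<mapsto> exp (2\<pi>i \<Sum>\<^sub>j\<^sub>l \<alpha>\<^sub>j C\<^sub>j\<^sub>l m\<^sub>l)\<close>. Since \<open>\<complex>\<^sup>*\<close> is
  divisible, every \<open>\<eta>\<close> is of this form. The monodromy only depends on \<open>C\<close> modulo integer matrices,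
  so that large integers can be added to \<open>C\<close>: this puts the weights into the Poincare domain (evaluate
  at \<open>(1, \<dots>, 1, 0)\<close>), and a choice avoiding finitely many proper subspaces at each \<open>j\<close> makes every
  family of at most \<open>r + d\<close> weights linearly independent.
\<close>

subsection \<open>Linear independence in the dual space\<close>

lemma sum_fun_apply: "(\<Sum>i\<in>A. g i) x = (\<Sum>i\<in>A. g i x :: complex)"
  by (induction A rule: infinite_finite_induct) auto

lemma dual_space_iff:
  "f \<in> dual_space \<longleftrightarrow> (\<forall>x y. f (x + y) = f x + f y) \<and> (\<forall>c x. f (c *s x) = c * f x)"
proof -
  have "vector_space ((*) :: complex \<Rightarrow> complex \<Rightarrow> complex)"
    by unfold_locales (auto simp: algebra_simps)
  then show ?thesis
    by (simp add: dual_space_def Vector_Spaces.linear_iff vec.vector_space_axioms)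
qed

lemma subspace_dual_space: "fun_space.subspace dual_space"
  by (auto simp: fun_space.subspace_def dual_space_iff fscale_def algebra_simps)

definition coordinate :: "'k \<Rightarrow> complex ^ 'k \<Rightarrow> complex" where
  "coordinate i = (\<lambda>x. x $ i)"

text \<open>Evaluation at \<open>axis i 1\<close> separates \<open>coordinate i\<close> from all
  other coordinates. Injectivity is carried along, here and below, because independence of an image
  set does not see repeated indices.\<close>

lemma coordinate_independent:
  "inj (coordinate :: 'k::finite \<Rightarrow> complex ^ 'k \<Rightarrow> complex) \<and>
   fun_space.independent (coordinate ` (A :: 'k set))"
proof
  show "inj (coordinate :: 'k \<Rightarrow> complex ^ 'k \<Rightarrow> complex)"
  proof (rule injI)
    fix i j :: 'k
    assume "coordinate i = (coordinate j :: complex ^ 'k \<Rightarrow> complex)"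
    then have "coordinate i (axis i 1) = (coordinate j (axis i 1) :: complex)" by simp
    then show "i = j" by (auto simp: coordinate_def axis_def split: if_splits)
  qed
  have "finite A" by simp
  then show "fun_space.independent (coordinate ` A)"
  proof induction
    case empty
    then show ?case by (simp add: fun_space.independent_empty)
  next
    case (insert i A)
    have "fun_space.span (coordinate ` A) \<subseteq> {f. f (axis i 1) = 0}"
      by (rule fun_space.span_minimal)
        (use insert in \<open>auto simp: coordinate_def axis_def fun_space.subspace_def fscale_def\<close>)
    moreover have "coordinate i (axis i 1) \<noteq> (0 :: complex)"
      by (simp add: coordinate_def)
    ultimately show ?case
      using insert by (auto simp: fun_space.independent_insert)
  qed
qed

text \<open>The ambient space of all functions is infinite-dimensional. Presenting the dual as the
  span of a finite independent set gives access to its dimension and to the exchange bound.\<close>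

lemma dual_space_eq_span_coordinate: "dual_space = fun_space.span (range coordinate)"
proof
  show "fun_space.span (range coordinate) \<subseteq> (dual_space :: (complex ^ 'a \<Rightarrow> complex) set)"
    by (rule fun_space.span_minimal)
      (auto simp: dual_space_iff coordinate_def subspace_dual_space)
  show "dual_space \<subseteq> fun_space.span (range (coordinate :: 'a \<Rightarrow> _))"
  proof
    fix f :: "complex ^ 'a \<Rightarrow> complex"
    assume f: "f \<in> dual_space"
    have f0: "f 0 = 0"
      using f by (metis (no_types, lifting) dual_space_iff mult_zero_left vector_smult_lzero)
    have f_sum: "f (sum g A) = (\<Sum>i\<in>A. f (g i))" for g and A :: "'a set"
      using f f0 by (induction A rule: infinite_finite_induct) (auto simp: dual_space_iff)
    have "f x = (\<Sum>i\<in>UNIV. fscale (f (axis i 1)) (coordinate i)) x" for x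
    proof -
      have "f x = f (\<Sum>i\<in>UNIV. x $ i *s axis i 1)" by (simp add: basis_expansion)
      also have "\<dots> = (\<Sum>i\<in>UNIV. x $ i * f (axis i 1))"
        using f by (simp add: f_sum dual_space_iff)
      also have "\<dots> = (\<Sum>i\<in>UNIV. fscale (f (axis i 1)) (coordinate i)) x"
        by (simp add: sum_fun_apply fscale_def coordinate_def mult.commute)
      finally show ?thesis .
    qed
    then have "f = (\<Sum>i\<in>UNIV. fscale (f (axis i 1)) (coordinate i))" by blast
    then show "f \<in> fun_space.span (range coordinate)"
      by (metis (no_types, lifting) fun_space.span_base fun_space.span_scale fun_space.span_sum
          rangeI)
  qed
qed

lemma card_range_coordinate: "card (range (coordinate :: 'k::finite \<Rightarrow> _)) = CARD('k)"
  using coordinate_independent[where 'k = 'k and A = UNIV] by (simp add: card_image)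

lemma dim_dual_space: "fun_space.dim (dual_space :: (complex ^ 'k \<Rightarrow> complex) set) = CARD('k)"
  using coordinate_independent[where 'k = 'k and A = UNIV]
  by (simp add: dual_space_eq_span_coordinate fun_space.dim_span_eq_card_independent
      card_range_coordinate del: fun_space.dim_span)

text \<open>A functional outside the span could be added to \<open>B\<close>, giving more
  independent elements than the coordinates that span the dual.\<close>

lemma independent_imp_span_dual_space:
  fixes B :: "(complex ^ 'k \<Rightarrow> complex) set"
  assumes "fun_space.independent B" "B \<subseteq> dual_space" "card B = CARD('k)"
  shows "fun_space.span B = dual_space"
proof
  show "fun_space.span B \<subseteq> dual_space"
    using assms(2) subspace_dual_space by (rule fun_space.span_minimal)
  show "dual_space \<subseteq> fun_space.span B"
  proof (rule ccontr)
    assume "\<not> dual_space \<subseteq> fun_space.span B"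
    then obtain f where f: "f \<in> dual_space" "f \<notin> fun_space.span B" by blast
    then have "f \<notin> B" by (auto intro: fun_space.span_base)
    with f assms have "fun_space.independent (insert f B)"
      by (simp add: fun_space.independent_insert)
    moreover have "insert f B \<subseteq> fun_space.span (range coordinate)"
      using f(1) assms(2) dual_space_eq_span_coordinate[where 'a = 'k] by auto
    ultimately have "card (insert f B) \<le> CARD('k)"
      using fun_space.independent_span_bound[of "range (coordinate :: 'k \<Rightarrow> _)" "insert f B"]
      by (simp add: card_range_coordinate)
    moreover have "finite B" using assms(3) by (metis card.infinite zero_less_card_finite less_numeral_extra(3))
    ultimately show False using \<open>f \<notin> B\<close> assms(3) by simp
  qed
qed

text \<open>Families of at most \<open>CARD('k)\<close> indices suffice: a larger family contains
  one with exactly \<open>CARD('k)\<close> indices, and that one already spans the dual.\<close>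

lemma uniform_maximal_rankI:
  fixes \<Lambda> :: "'i \<Rightarrow> complex ^ 'k \<Rightarrow> complex"
  assumes "\<Lambda> ` N \<subseteq> dual_space"
    and indep: "\<And>K. K \<subseteq> N \<Longrightarrow> finite K \<Longrightarrow> card K \<le> CARD('k) \<Longrightarrow>
      inj_on \<Lambda> K \<and> fun_space.independent (\<Lambda> ` K)"
    and "finite N"
  shows "uniform_maximal_rank N \<Lambda>"
  unfolding uniform_maximal_rank_def
proof (intro allI impI)
  fix K assume K: "K \<subseteq> N"
  then have "finite K" using assms(3) finite_subset by blast
  show "fun_space.dim (fun_space.span (\<Lambda> ` K)) = min (card K) CARD('k)"
  proof (cases "card K \<le> CARD('k)")
    case True
    then show ?thesis
      using indep[OF K \<open>finite K\<close>]
      by (simp add: fun_space.dim_span_eq_card_independent card_image del: fun_space.dim_span)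
  next
    case False
    then obtain K' where K': "K' \<subseteq> K" "card K' = CARD('k)" "finite K'"
      by (meson nat_le_linear obtain_subset_with_card_n)
    then have "inj_on \<Lambda> K' \<and> fun_space.independent (\<Lambda> ` K')"
      using indep K by simp
    then have "fun_space.span (\<Lambda> ` K') = dual_space"
      using K K' assms(1) by (intro independent_imp_span_dual_space) (auto simp: card_image)
    then have "dual_space \<subseteq> fun_space.span (\<Lambda> ` K)"
      by (metis K'(1) fun_space.span_mono image_mono)
    moreover have "fun_space.span (\<Lambda> ` K) \<subseteq> dual_space"
      using K assms(1) subspace_dual_space by (intro fun_space.span_minimal) auto
    ultimately show ?thesis using False by (simp add: dim_dual_space subset_antisym del: fun_space.dim_span)
  qed
qed

lemma spanning_configurationI:
  fixes \<Lambda> :: "'i \<Rightarrow> complex ^ 'k \<Rightarrow> complex"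
  assumes "\<Lambda> ` N \<subseteq> dual_space" "finite N" "CARD('k) \<le> card N"
    and indep: "\<And>K. K \<subseteq> N \<Longrightarrow> finite K \<Longrightarrow> card K \<le> CARD('k) \<Longrightarrow>
      inj_on \<Lambda> K \<and> fun_space.independent (\<Lambda> ` K)"
  shows "spanning_configuration N \<Lambda>"
proof -
  obtain K where K: "K \<subseteq> N" "card K = CARD('k)" "finite K"
    using assms(3) by (meson obtain_subset_with_card_n)
  then have "inj_on \<Lambda> K \<and> fun_space.independent (\<Lambda> ` K)"
    using indep by simp
  then have "fun_space.span (\<Lambda> ` K) = dual_space"
    using K assms(1) by (intro independent_imp_span_dual_space) (auto simp: card_image)
  then have "dual_space \<subseteq> fun_space.span (\<Lambda> ` N)"
    by (metis K(1) fun_space.span_mono image_mono)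
  moreover have "fun_space.span (\<Lambda> ` N) \<subseteq> dual_space"
    using assms(1) subspace_dual_space by (intro fun_space.span_minimal) auto
  ultimately show ?thesis
    using assms unfolding spanning_configuration_def by blast
qed

text \<open>Otherwise adding \<open>j\<close> would not raise the dimension of the span, whereas the
  rank condition makes it grow by one below \<open>CARD('k)\<close>.\<close>

lemma uniform_maximal_rank_notin_span:
  fixes \<beta> :: "'i \<Rightarrow> complex ^ 'k \<Rightarrow> complex"
  assumes "uniform_maximal_rank N \<beta>" "insert j B \<subseteq> N" "finite B" "j \<notin> B" "card B < CARD('k)"
  shows "\<beta> j \<notin> fun_space.span (\<beta> ` B)"
proof
  assume "\<beta> j \<in> fun_space.span (\<beta> ` B)"
  then have "fun_space.span (\<beta> ` insert j B) = fun_space.span (\<beta> ` B)"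
    by (simp add: fun_space.span_redundant)
  moreover have "fun_space.dim (fun_space.span (\<beta> ` insert j B)) = Suc (card B)"
    using assms unfolding uniform_maximal_rank_def
    by (metis Suc_leI card_insert_disjoint min.absorb1)
  moreover have "fun_space.dim (fun_space.span (\<beta> ` B)) = card B"
    using assms unfolding uniform_maximal_rank_def
    by (metis insert_subset less_imp_le min.absorb1)
  ultimately show False by simp
qed

lemma card_ge_dim_of_spanning_configuration:
  fixes \<beta> :: "'i \<Rightarrow> complex ^ 'k \<Rightarrow> complex"
  assumes "spanning_configuration N \<beta>"
  shows "CARD('k) \<le> card N"
proof -
  have "fun_space.dim (dual_space :: (complex ^ 'k \<Rightarrow> complex) set) \<le> card (\<beta> ` N)"
    using assms unfolding spanning_configuration_def
    by (intro fun_space.dim_le_card) auto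
  also have "\<dots> \<le> card N"
    using assms by (simp add: card_image_le spanning_configuration_def)
  finally show ?thesis by (simp add: dim_dual_space)
qed

section \<open>Avoiding finitely many subspaces by integer shifts\<close>

text \<open>
  The shifts \<open>m l\<close> are chosen one after the other: unless \<open>W\<close> contains \<open>e k\<close>, at most one multiple
  of \<open>e k\<close> moves \<open>u\<close> into \<open>W\<close>.
\<close>

lemma avoid_subspaces:
  fixes u :: "'v \<Rightarrow> complex" and e :: "'l \<Rightarrow> 'v \<Rightarrow> complex" and b :: "'l \<Rightarrow> nat"
  assumes "finite L" "finite \<W>" "\<And>W. W \<in> \<W> \<Longrightarrow> fun_space.subspace W"
    and "\<And>W. W \<in> \<W> \<Longrightarrow> \<not> (u \<in> W \<and> e ` L \<subseteq> W)"
  shows "\<exists>m. (\<forall>l\<in>L. b l \<le> m l) \<and>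
    (\<forall>W\<in>\<W>. u + (\<Sum>l\<in>L. fscale (of_nat (m l)) (e l)) \<notin> W)"
  using assms(1,4)
proof (induction L arbitrary: u rule: finite_induct)
  case empty
  then show ?case by auto
next
  case (insert k L)
  \<comment> \<open>The shifts \<open>p\<close> along \<open>e k\<close> after which the hypothesis
    of the induction over \<open>L\<close> fails for \<open>W\<close>.\<close>
  define bad where "bad W = {p. u + fscale (of_nat p) (e k) \<in> W \<and> e ` L \<subseteq> W}" for W
  have "finite (bad W)" if "W \<in> \<W>" for W
  proof -
    have "p = q" if p: "p \<in> bad W" and q: "q \<in> bad W" for p q
    proof (rule ccontr)
      assume "p \<noteq> q"
      note W = assms(3)[OF \<open>W \<in> \<W>\<close>]
      \<comment> \<open>The difference is a nonzero multiple of \<open>e k\<close>. So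
        \<open>e k\<close> lies in \<open>W\<close>, hence also \<open>u\<close>, against the
        assumption on \<open>W\<close>.\<close>
      have "(u + fscale (of_nat p) (e k)) - (u + fscale (of_nat q) (e k)) \<in> W"
        using p q W unfolding bad_def by (blast intro: fun_space.subspace_diff)
      then have "fscale (1 / (of_nat p - of_nat q))
          ((u + fscale (of_nat p) (e k)) - (u + fscale (of_nat q) (e k))) \<in> W"
        using W by (rule fun_space.subspace_scale[rotated])
      moreover have "fscale (1 / (of_nat p - of_nat q))
          ((u + fscale (of_nat p) (e k)) - (u + fscale (of_nat q) (e k))) = e k"
        using \<open>p \<noteq> q\<close> by (auto simp: fscale_def fun_eq_iff field_simps)
      ultimately have ek: "e k \<in> W" by simp
      have "(u + fscale (of_nat p) (e k)) - fscale (of_nat p) (e k) \<in> W"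
        using p W ek unfolding bad_def
        by (blast intro: fun_space.subspace_diff fun_space.subspace_scale)
      then have "u \<in> W" by simp
      with ek p insert.prems[OF \<open>W \<in> \<W>\<close>] show False by (auto simp: bad_def)
    qed
    then have "is_singleton (bad W) \<or> bad W = {}"
      using is_singletonI'[of "bad W"] by blast
    then show ?thesis by (auto elim: is_singletonE)
  qed
  then have "finite (\<Union>W\<in>\<W>. bad W)" using assms(2) by blast
  \<comment> \<open>Excluding the numbers below \<open>b k\<close> as well enforces the lower
    bound.\<close>
  then have "finite ((\<Union>W\<in>\<W>. bad W) \<union> {..<b k})" by simp
  from ex_new_if_finite[OF infinite_UNIV_nat this]
  obtain p where "p \<notin> (\<Union>W\<in>\<W>. bad W) \<union> {..<b k}" ..
  then have p: "p \<notin> (\<Union>W\<in>\<W>. bad W)" "b k \<le> p" by auto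
  have "\<exists>m. (\<forall>l\<in>L. b l \<le> m l) \<and>
    (\<forall>W\<in>\<W>. (u + fscale (of_nat p) (e k)) + (\<Sum>l\<in>L. fscale (of_nat (m l)) (e l)) \<notin> W)"
  proof (rule insert.IH)
    fix W assume "W \<in> \<W>"
    then show "\<not> (u + fscale (of_nat p) (e k) \<in> W \<and> e ` L \<subseteq> W)"
      using p(1) by (simp add: bad_def)
  qed
  then obtain m where m: "(\<forall>l\<in>L. b l \<le> m l) \<and>
    (\<forall>W\<in>\<W>. (u + fscale (of_nat p) (e k)) + (\<Sum>l\<in>L. fscale (of_nat (m l)) (e l)) \<notin> W)" ..
  have eq: "(\<Sum>l\<in>L. fscale (of_nat ((m(k := p)) l)) (e l)) = (\<Sum>l\<in>L. fscale (of_nat (m l)) (e l))"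
    using insert.hyps(2) by (intro sum.cong) auto
  show ?case
  proof (intro exI[of _ "m(k := p)"] conjI ballI)
    show "b l \<le> (m(k := p)) l" if "l \<in> insert k L" for l
      using that m p(2) by auto
    show "u + (\<Sum>l\<in>insert k L. fscale (of_nat ((m(k := p)) l)) (e l)) \<notin> W" if "W \<in> \<W>" for W
      using that m insert.hyps eq by (simp add: add.assoc)
  qed
qed

subsection \<open>Characters as exponentials\<close>

lemma additive_group_simps [simp]:
  "carrier additive_group = UNIV" "x \<otimes>\<^bsub>additive_group\<^esub> y = x + y" "\<one>\<^bsub>additive_group\<^esub> = 0"
  by (simp_all add: additive_group_def)

lemma group_additive_group: "group (additive_group :: 'a::ab_group_add monoid)"
  by (rule groupI) (auto simp: add.assoc intro: left_minus)

lemma inv_additive_group [simp]: "inv\<^bsub>additive_group\<^esub> x = - (x :: 'a::ab_group_add)"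
  by (rule group.inv_equality[OF group_additive_group]) auto

text \<open>
  Induction on the support \<open>F\<close>: the values \<open>\<alpha> k\<close>, \<open>\<alpha> \<in> M\<close>, at a new coordinate \<open>k\<close> form a subgroup
  \<open>n\<int>\<close>, and the value of \<open>\<theta>\<close> at one element \<open>\<alpha>0\<close> with \<open>\<alpha>0 k = n\<close> determines \<open>c k\<close>. No
  extension of \<open>\<theta>\<close> to a larger group has to be constructed.
\<close>

lemma character_eq_exp_aux:
  fixes M :: "('s \<Rightarrow> int) set" and \<theta> :: "('s \<Rightarrow> int) \<Rightarrow> complex"
  assumes "finite F" "subgroup M additive_group" "\<And>\<alpha>. \<alpha> \<in> M \<Longrightarrow> \<forall>j. j \<notin> F \<longrightarrow> \<alpha> j = 0"
    and "\<And>\<alpha> \<alpha>'. \<alpha> \<in> M \<Longrightarrow> \<alpha>' \<in> M \<Longrightarrow> \<theta> (\<alpha> + \<alpha>') = \<theta> \<alpha> * \<theta> \<alpha>'"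
    and "\<And>\<alpha>. \<alpha> \<in> M \<Longrightarrow> \<theta> \<alpha> \<noteq> 0"
  shows "\<exists>c. \<forall>\<alpha>\<in>M. \<theta> \<alpha> = exp (\<Sum>j\<in>F. of_int (\<alpha> j) * c j)"
  using assms
proof (induction F arbitrary: M rule: finite_induct)
  case (empty M)
  have "\<theta> \<alpha> = 1" if "\<alpha> \<in> M" for \<alpha>
  proof -
    \<comment> \<open>With empty support \<open>\<alpha>\<close> is zero, so its value is a nonzero
      idempotent.\<close>
    have "\<alpha> + \<alpha> = \<alpha>" using empty(2)[OF that] by (auto simp: fun_eq_iff)
    then have "\<theta> \<alpha> * \<theta> \<alpha> = \<theta> \<alpha>" using empty(3)[OF that that] by metis
    then show ?thesis using empty(4)[OF that] by simp
  qed
  then show ?case by simp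
next
  case (insert k F M)
  have \<theta>_add: "\<theta> (x + y) = \<theta> x * \<theta> y" if "x \<in> M" "y \<in> M" for x y
    using that by (rule insert.prems(3))
  have \<theta>_nz: "\<theta> x \<noteq> 0" if "x \<in> M" for x
    using that by (rule insert.prems(4))
  have M0: "0 \<in> M" and Madd: "\<And>x y. x \<in> M \<Longrightarrow> y \<in> M \<Longrightarrow> x + y \<in> M"
    and Mneg: "\<And>x. x \<in> M \<Longrightarrow> - x \<in> M"
    using subgroup.one_closed[OF insert.prems(1)] subgroup.m_closed[OF insert.prems(1)]
      subgroup.m_inv_closed[OF insert.prems(1)]
    by simp_all
  have Mdiff: "x - y \<in> M" if "x \<in> M" "y \<in> M" for x y
    using Madd[OF that(1) Mneg[OF that(2)]] by simp
  define M' where "M' = {\<alpha>\<in>M. \<alpha> k = 0}"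
  have M': "subgroup M' additive_group"
    by (rule group.subgroupI[OF group_additive_group])
      (use M0 in \<open>auto simp: M'_def intro: Madd Mneg\<close>)
  have "\<exists>c. \<forall>\<alpha>\<in>M'. \<theta> \<alpha> = exp (\<Sum>j\<in>F. of_int (\<alpha> j) * c j)"
  proof (rule insert.IH[OF M'])
    show "\<forall>j. j \<notin> F \<longrightarrow> \<alpha> j = 0" if "\<alpha> \<in> M'" for \<alpha>
      using insert.prems(2)[of \<alpha>] that by (force simp: M'_def)
    show "\<theta> (\<alpha> + \<alpha>') = \<theta> \<alpha> * \<theta> \<alpha>'" if "\<alpha> \<in> M'" "\<alpha>' \<in> M'" for \<alpha> \<alpha>'
      using \<theta>_add that by (auto simp only: M'_def mem_Collect_eq)
    show "\<theta> \<alpha> \<noteq> 0" if "\<alpha> \<in> M'" for \<alpha>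
      using \<theta>_nz[of \<alpha>] that by (simp add: M'_def)
  qed
  then obtain c where c: "\<forall>\<alpha>\<in>M'. \<theta> \<alpha> = exp (\<Sum>j\<in>F. of_int (\<alpha> j) * c j)" ..
  show ?case
  proof (cases "M \<subseteq> M'")
    \<comment> \<open>Every element of \<open>M\<close> vanishes at \<open>k\<close>, so any value
      of \<open>c k\<close> will do.\<close>
    case True
    then have "\<forall>\<alpha>\<in>M. \<theta> \<alpha> = exp (\<Sum>j\<in>insert k F. of_int (\<alpha> j) * c j)"
      using c insert.hyps by (auto simp: M'_def)
    then show ?thesis by (intro exI[of _ c])
  next
    case False
    then obtain \<alpha>1 where "\<alpha>1 \<in> M" "\<alpha>1 k \<noteq> 0" by (auto simp: M'_def)
    \<comment> \<open>A sign change makes the value at \<open>k\<close> positive, so that a least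
      positive value \<open>n\<close> exists.\<close>
    then obtain \<alpha>2 where "\<alpha>2 \<in> M" "\<alpha>2 k > 0"
      using Mneg[of \<alpha>1] by (cases "\<alpha>1 k > 0") force+
    then have ex: "\<exists>n. n > 0 \<and> (\<exists>\<alpha>\<in>M. \<alpha> k = int n)"
      by (intro exI[of _ "nat (\<alpha>2 k)"]) force
    define n where "n = (LEAST n. n > 0 \<and> (\<exists>\<alpha>\<in>M. \<alpha> k = int n))"
    obtain \<alpha>0 where n: "n > 0" "\<alpha>0 \<in> M" "\<alpha>0 k = int n"
      using LeastI_ex[OF ex] unfolding n_def by blast
    have least: "\<alpha> k \<noteq> int m" if "m < n" "m > 0" "\<alpha> \<in> M" for m \<alpha>
      using not_less_Least[of m "\<lambda>n. n > 0 \<and> (\<exists>\<alpha>\<in>M. \<alpha> k = int n)"] that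
      unfolding n_def by blast
    obtain w where w: "\<theta> \<alpha>0 = exp w"
      using \<theta>_nz n(2) by (metis exp_Ln)
    \<comment> \<open>The entry at \<open>k\<close> solves \<open>w = (\<Sum>j\<in>F. of_int
      (\<alpha>0 j) * c j) + of_nat n * c' k\<close>. Dividing a logarithm by \<open>n\<close> is
      the place where divisibility of the target group enters.\<close>
    define c' where
      "c' = c(k := (w - (\<Sum>j\<in>F. of_int (\<alpha>0 j) * c j)) / of_nat n)"
    have nat_mult: "(\<lambda>j. int p * \<alpha>0 j) \<in> M \<and> \<theta> (\<lambda>j. int p * \<alpha>0 j) = exp (of_nat p * w)" for p
    proof (induction p)
      case 0
      have "\<theta> 0 = 1" using \<theta>_add[OF M0 M0] \<theta>_nz[OF M0] by simp
      with M0 show ?case by (simp add: zero_fun_def)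
    next
      case (Suc p)
      have eq: "(\<lambda>j. int (Suc p) * \<alpha>0 j) = \<alpha>0 + (\<lambda>j. int p * \<alpha>0 j)"
        by (auto simp: fun_eq_iff algebra_simps)
      have "\<theta> (\<alpha>0 + (\<lambda>j. int p * \<alpha>0 j)) = exp w * exp (of_nat p * w)"
        using Suc n(2) w by (metis \<theta>_add)
      also have "\<dots> = exp (of_nat (Suc p) * w)"
        by (simp add: exp_add distrib_right)
      finally show ?case
        unfolding eq using Suc Madd[OF n(2)] by blast
    qed
    have int_mult: "(\<lambda>j. q * \<alpha>0 j) \<in> M \<and> \<theta> (\<lambda>j. q * \<alpha>0 j) = exp (of_int q * w)" for q
    proof (cases "q \<ge> 0")
      case True
      then show ?thesis using nat_mult[of "nat q"] by (simp add: of_nat_nat)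
    next
      case False
      define p where "p = nat (- q)"
      have q: "q = - int p" using False by (simp add: p_def)
      have eq: "(\<lambda>j. q * \<alpha>0 j) = - (\<lambda>j. int p * \<alpha>0 j)" by (auto simp: q)
      have mem: "(\<lambda>j. q * \<alpha>0 j) \<in> M" using nat_mult[of p] Mneg by (simp add: eq)
      have "\<theta> (\<lambda>j. q * \<alpha>0 j) * \<theta> (\<lambda>j. int p * \<alpha>0 j) = \<theta> 0"
        using \<theta>_add[OF mem, of "\<lambda>j. int p * \<alpha>0 j"] nat_mult[of p] by (simp add: eq)
      also have "\<theta> 0 = 1" using \<theta>_add[OF M0 M0] \<theta>_nz[OF M0] by simp
      finally have "\<theta> (\<lambda>j. q * \<alpha>0 j) * exp (of_nat p * w) = 1" using nat_mult[of p] by simp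
      then have "\<theta> (\<lambda>j. q * \<alpha>0 j) = exp (of_int q * w)"
        by (simp add: q exp_minus field_simps)
      with mem show ?thesis by simp
    qed
    have "\<theta> \<alpha> = exp (\<Sum>j\<in>insert k F. of_int (\<alpha> j) * c' j)" if \<alpha>: "\<alpha> \<in> M" for \<alpha>
    proof -
      define q where "q = \<alpha> k div int n"
      \<comment> \<open>Division with remainder: the entry of \<open>\<alpha>'\<close> at
        \<open>k\<close> lies in the range from 0 to \<open>n - 1\<close>, hence is 0 by minimality
        of \<open>n\<close>. So \<open>\<alpha>'\<close> falls under the induction hypothesis and
        the rest is a multiple of \<open>\<alpha>0\<close>.\<close>
      define \<alpha>' where "\<alpha>' = \<alpha> - (\<lambda>j. q * \<alpha>0 j)"
      have "\<alpha>' \<in> M" using Mdiff[OF \<alpha>] int_mult by (simp add: \<alpha>'_def)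
      have "\<alpha>' k = \<alpha> k mod int n"
        by (simp add: \<alpha>'_def q_def n(3) minus_div_mult_eq_mod)
      then have range: "0 \<le> \<alpha>' k" "\<alpha>' k < int n" using n(1) by simp_all
      have "\<alpha>' k = 0"
      proof (rule ccontr)
        assume "\<alpha>' k \<noteq> 0"
        with range have "nat (\<alpha>' k) < n" "0 < nat (\<alpha>' k)" by linarith+
        with least[of "nat (\<alpha>' k)" \<alpha>'] \<open>\<alpha>' \<in> M\<close> range(1) show False by simp
      qed
      with \<open>\<alpha>' \<in> M\<close> have "\<alpha>' \<in> M'" by (simp add: M'_def)
      have \<alpha>k: "\<alpha> k = q * int n" using \<open>\<alpha>' k = 0\<close> by (simp add: \<alpha>'_def n(3))
      have "\<theta> \<alpha> = \<theta> (\<alpha>' + (\<lambda>j. q * \<alpha>0 j))" by (simp add: \<alpha>'_def)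
      also have "\<dots> = exp (\<Sum>j\<in>F. of_int (\<alpha>' j) * c j) * exp (of_int q * w)"
        using \<theta>_add[OF \<open>\<alpha>' \<in> M\<close>] int_mult[of q] bspec[OF c \<open>\<alpha>' \<in> M'\<close>] by simp
      also have "\<dots> = exp ((\<Sum>j\<in>F. of_int (\<alpha>' j) * c j) + of_int q * w)"
        by (simp add: exp_add)
      also have "(\<Sum>j\<in>F. of_int (\<alpha>' j) * c j) =
          (\<Sum>j\<in>F. of_int (\<alpha> j) * c j) - of_int q * (\<Sum>j\<in>F. of_int (\<alpha>0 j) * c j)"
        by (simp add: \<alpha>'_def sum_subtractf sum_distrib_left algebra_simps)
      also have "\<dots> + of_int q * w = (\<Sum>j\<in>F. of_int (\<alpha> j) * c j) + of_int (\<alpha> k) * c' k"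
      proof -
        have "of_int (\<alpha> k) * c' k = of_int q * (w - (\<Sum>j\<in>F. of_int (\<alpha>0 j) * c j))"
          using n(1) by (simp add: \<alpha>k c'_def)
        then show ?thesis by (simp add: right_diff_distrib)
      qed
      also have "(\<Sum>j\<in>F. of_int (\<alpha> j) * c j) = (\<Sum>j\<in>F. of_int (\<alpha> j) * c' j)"
        using insert.hyps by (intro sum.cong) (auto simp: c'_def)
      finally show ?thesis using insert.hyps by (simp add: add.commute)
    qed
    then show ?thesis by (intro exI[of _ c'] ballI) simp
  qed
qed

lemma character_eq_exp:
  fixes M :: "('s::finite \<Rightarrow> int) set" and \<theta> :: "('s \<Rightarrow> int) \<Rightarrow> complex"
  assumes "subgroup M additive_group" "\<theta> \<in> carrier (character_group M)"
  shows "\<exists>c. \<forall>\<alpha>\<in>M. \<theta> \<alpha> = exp (\<Sum>j\<in>UNIV. of_int (\<alpha> j) * c j)"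
  using assms
  by (intro character_eq_exp_aux) (auto simp: character_group_def Cstar_def hom_def additive_group_def)

text \<open>\<open>g\<close> is a character of the full lattice, so it has some exponents
  \<open>c\<close>. These need not equal \<open>w\<close>, but their exponentials agree, which is
  enough because the coefficients are integers.\<close>

lemma multiplicative_eq_exp:
  fixes g :: "int ^ 'r \<Rightarrow> complex"
  assumes "\<And>m m'. g (m + m') = g m * g m'" "\<And>m. g m \<noteq> 0" "\<And>l. g (axis l 1) = exp (w l)"
  shows "g m = exp (\<Sum>l\<in>UNIV. of_int (m $ l) * w l)"
proof -
  have "(\<lambda>a. g (vec_lambda a)) \<in> carrier (character_group UNIV)"
  proof -
    have "g (vec_lambda (a + b)) = g (vec_lambda a) * g (vec_lambda b)" for a b
      using assms(1)[of "vec_lambda a" "vec_lambda b"]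
      by (simp add: plus_vec_def plus_fun_def)
    then show ?thesis
      using assms(2) by (auto simp: character_group_def Cstar_def hom_def)
  qed
  moreover have "subgroup (UNIV :: ('r \<Rightarrow> int) set) additive_group"
    using group.subgroup_self[OF group_additive_group] by simp
  ultimately obtain c where
    "\<forall>a\<in>UNIV. g (vec_lambda a) = exp (\<Sum>l\<in>UNIV. of_int (a l) * c l)"
    by (elim exE[OF character_eq_exp, rotated 2])
  then have c: "g (vec_lambda a) = exp (\<Sum>l\<in>UNIV. of_int (a l) * c l)" for a
    by simp
  have "exp (c l) = exp (w l)" for l
  proof -
    have "exp (w l) = g (vec_lambda (\<lambda>i. if i = l then 1 else 0))"
      using assms(3)[of l] by (simp add: axis_def)
    also have "\<dots> = exp (c l)"
      by (simp add: c if_distrib[of of_int] if_distrib[of "\<lambda>x. x * _"] cong: if_cong)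
    finally show ?thesis ..
  qed
  then have "exp (of_int q * c l) = exp (of_int q * w l)" for q l
    by (metis exp_power_int)
  then show ?thesis
    using c[of "vec_nth m"] by (simp add: exp_sum)
qed

text \<open>For each basis vector, \<open>character_eq_exp\<close> gives logarithms linear in
  \<open>\<alpha>\<close>; for fixed \<open>\<alpha>\<close>, multiplicativity in \<open>m\<close>
  combines them into a bilinear exponent.\<close>

lemma character_log:
  fixes \<eta> :: "int ^ 'r \<Rightarrow> ('s::finite \<Rightarrow> int) \<Rightarrow> complex"
  assumes "subgroup M additive_group" "\<eta> \<in> hom additive_group (character_group M)"
  shows "\<exists>c :: 's \<Rightarrow> 'r \<Rightarrow> complex. \<forall>m. \<forall>\<alpha>\<in>M.
    \<eta> m \<alpha> = exp (2 * of_real pi * \<i> * (\<Sum>j\<in>UNIV. \<Sum>l\<in>UNIV. of_int (\<alpha> j) * c j l * of_int (m $ l)))"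
proof -
  have carrier: "\<eta> m \<in> carrier (character_group M)" for m
    using hom_in_carrier[OF assms(2), of m] by simp
  have "\<exists>c. \<forall>\<alpha>\<in>M. \<eta> (axis l 1) \<alpha> = exp (\<Sum>j\<in>UNIV. of_int (\<alpha> j) * c j)" for l
    using assms(1) carrier by (rule character_eq_exp)
  then have "\<forall>l. \<exists>c. \<forall>\<alpha>\<in>M. \<eta> (axis l 1) \<alpha> = exp (\<Sum>j\<in>UNIV. of_int (\<alpha> j) * c j)" ..
  then obtain c where c: "\<forall>l. \<forall>\<alpha>\<in>M. \<eta> (axis l 1) \<alpha> = exp (\<Sum>j\<in>UNIV. of_int (\<alpha> j) * c l j)"
    by (rule choice[THEN exE])
  have "\<eta> m \<alpha> = exp (2 * of_real pi * \<i> *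
      (\<Sum>j\<in>UNIV. \<Sum>l\<in>UNIV. of_int (\<alpha> j) * (c l j / (2 * of_real pi * \<i>)) * of_int (m $ l)))"
    if \<alpha>: "\<alpha> \<in> M" for m \<alpha>
  proof -
    have "\<eta> m \<alpha> = exp (\<Sum>l\<in>UNIV. of_int (m $ l) * (\<Sum>j\<in>UNIV. of_int (\<alpha> j) * c l j))"
    proof (rule multiplicative_eq_exp)
      show "\<eta> (m + m') \<alpha> = \<eta> m \<alpha> * \<eta> m' \<alpha>" for m m'
        using hom_mult[OF assms(2), of m m'] \<alpha> by (simp add: character_group_def)
      show "\<eta> m \<alpha> \<noteq> 0" for m
        using carrier[of m] \<alpha> by (auto simp: character_group_def hom_def Cstar_def)
      show "\<eta> (axis l 1) \<alpha> = exp (\<Sum>j\<in>UNIV. of_int (\<alpha> j) * c l j)" for l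
        using c \<alpha> by simp
    qed
    also have "(\<Sum>l\<in>UNIV. of_int (m $ l) * (\<Sum>j\<in>UNIV. of_int (\<alpha> j) * c l j)) =
        (\<Sum>j\<in>UNIV. \<Sum>l\<in>UNIV. of_int (m $ l) * (of_int (\<alpha> j) * c l j))"
      unfolding sum_distrib_left by (rule sum.swap)
    also have "\<dots> = 2 * of_real pi * \<i> *
      (\<Sum>j\<in>UNIV. \<Sum>l\<in>UNIV. of_int (\<alpha> j) * (c l j / (2 * of_real pi * \<i>)) * of_int (m $ l))"
      unfolding sum_distrib_left by (intro sum.cong refl) (simp add: field_simps)
    finally show ?thesis .
  qed
  \<comment> \<open>The logarithms are divided by the factor that each period carries, so that they
    can serve as coefficients of the weights.\<close>
  then show ?thesis by (intro exI[of _ "\<lambda>j l. c l j / (2 * of_real pi * \<i>)"]) blast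
qed

text \<open>The double sum changes by the integer \<open>q\<close>. This is the freedom to move the
  weights without touching the monodromy.\<close>

lemma exp_period_shift:
  fixes c :: "'s::finite \<Rightarrow> 'r::finite \<Rightarrow> complex" and p :: "'s \<Rightarrow> 'r \<Rightarrow> nat"
  shows "exp (2 * of_real pi * \<i> *
      (\<Sum>j\<in>UNIV. \<Sum>l\<in>UNIV. of_int (a j) * (c j l + of_nat (p j l)) * of_int (m l))) =
    exp (2 * of_real pi * \<i> * (\<Sum>j\<in>UNIV. \<Sum>l\<in>UNIV. of_int (a j) * c j l * of_int (m l)))"
proof -
  define q where "q = (\<Sum>j\<in>UNIV. \<Sum>l\<in>UNIV. a j * int (p j l) * m l)"
  have "(\<Sum>j\<in>UNIV. \<Sum>l\<in>UNIV. of_int (a j) * (c j l + of_nat (p j l)) * of_int (m l)) =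
      (\<Sum>j\<in>UNIV. \<Sum>l\<in>UNIV. of_int (a j) * c j l * of_int (m l)) + (of_int q :: complex)"
    unfolding q_def of_int_sum of_int_mult of_int_of_nat_eq sum.distrib[symmetric]
    by (simp only: distrib_left distrib_right)
  moreover have "exp (2 * of_real pi * \<i> * of_int q) = 1"
    using exp_integer_2pi[of "of_int q"] by (simp add: mult_ac)
  ultimately show ?thesis by (simp only: distrib_left exp_add mult_1_right)
qed

subsection \<open>Extended weights in general position\<close>

text \<open>This inclusion of the second factor becomes the isomorphism onto the isotropy of the
  support.\<close>

definition zero_extension :: "complex ^ 'd \<Rightarrow> complex ^ ('r::finite + 'd::finite)" where
  "zero_extension v = (\<chi> k. case k of Inl _ \<Rightarrow> 0 | Inr i \<Rightarrow> v $ i)"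

lemma zero_extension_nth [simp]:
  "zero_extension v $ Inl l = 0" "zero_extension v $ Inr i = v $ i"
  by (simp_all add: zero_extension_def)

text \<open>\<open>Inl\<close> indexes the support and \<open>Inr\<close> the residual weights. The
  matrix \<open>C\<close> is invisible on the second factor; it carries the monodromy.\<close>

definition extended_weight ::
    "('s \<Rightarrow> complex ^ 'd \<Rightarrow> complex) \<Rightarrow> ('s \<Rightarrow> 'r \<Rightarrow> complex) \<Rightarrow> 'r + 's \<Rightarrow>
     complex ^ ('r::finite + 'd::finite) \<Rightarrow> complex" where
  "extended_weight \<beta> C k = (case k of Inl l \<Rightarrow> coordinate (Inl l)
     | Inr j \<Rightarrow> \<lambda>x. (\<Sum>l\<in>UNIV. C j l * x $ Inl l) + \<beta> j (\<chi> i. x $ Inr i))"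

lemma extended_weight_simps:
  "extended_weight \<beta> C (Inl l) = coordinate (Inl l)"
  "extended_weight \<beta> C (Inr j) = (\<lambda>x. (\<Sum>l\<in>UNIV. C j l * x $ Inl l) + \<beta> j (\<chi> i. x $ Inr i))"
  by (simp_all add: extended_weight_def)

text \<open>Changing row \<open>j\<close> translates one weight along the support coordinates, which
  is the shape treated by \<open>avoid_subspaces\<close>.\<close>

lemma extended_weight_add:
  "extended_weight \<beta> (\<lambda>j l. C j l + D j l) (Inr j) =
   extended_weight \<beta> C (Inr j) + (\<Sum>l\<in>UNIV. fscale (D j l) (coordinate (Inl l)))"
  by (auto simp: extended_weight_simps fun_eq_iff sum_fun_apply fscale_def coordinate_def
      distrib_right sum.distrib)

lemma extended_weight_dual_space:
  fixes \<beta> :: "'s \<Rightarrow> complex ^ 'd \<Rightarrow> complex" and C :: "'s \<Rightarrow> 'r::finite \<Rightarrow> complex"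
  assumes "range \<beta> \<subseteq> dual_space"
  shows "extended_weight \<beta> C k \<in> dual_space"
proof (cases k)
  case (Inl l)
  then show ?thesis by (simp add: extended_weight_simps coordinate_def dual_space_iff)
next
  case (Inr j)
  have \<beta>: "\<beta> j (x + y) = \<beta> j x + \<beta> j y" "\<beta> j (c *s x) = c * \<beta> j x" for x y c
    using assms dual_space_iff by blast+
  have \<chi>: "(\<chi> i. (x + y) $ Inr i) = (\<chi> i. x $ Inr i) + (\<chi> i. y $ Inr i)"
    "(\<chi> i. (c *s x) $ Inr i) = c *s (\<chi> i. x $ Inr i)"
    for x y :: "complex ^ ('r + 'd)" and c
    by (simp_all add: vec_eq_iff)
  show ?thesis
    unfolding dual_space_iff Inr extended_weight_simps \<chi> \<beta>
    by (simp add: distrib_left sum.distrib sum_distrib_left mult.left_commute)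
qed

text \<open>Precomposition is linear in the function. With \<open>zero_extension\<close> for
  \<open>g\<close> it is restriction to the second factor.\<close>

lemma span_comp:
  assumes "f \<in> fun_space.span S"
  shows "f \<circ> g \<in> fun_space.span ((\<lambda>f. f \<circ> g) ` S)"
  using assms
proof (induction rule: fun_space.span_induct_alt)
  case base
  have "0 \<circ> g = (0 :: _ \<Rightarrow> complex)" by (simp add: fun_eq_iff)
  then show ?case by (simp only: fun_space.span_zero)
next
  case (step c x y)
  have "(fscale c x + y) \<circ> g = fscale c (x \<circ> g) + (y \<circ> g)" by (simp add: fun_eq_iff fscale_def)
  moreover have "x \<circ> g \<in> fun_space.span ((\<lambda>f. f \<circ> g) ` S)"
    using step by (intro fun_space.span_base) auto
  ultimately show ?case
    using step by (simp only: fun_space.span_add fun_space.span_scale)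
qed

text \<open>Restricting to the second factor \<open>\<complex>\<^sup>d\<close> kills the coordinates of \<open>\<complex>\<^sup>r\<close> and
  turns the extended weights back into the functionals \<open>\<beta> j\<close>.\<close>

lemma extended_weight_notin_span:
  fixes \<beta> :: "'s::finite \<Rightarrow> complex ^ 'd \<Rightarrow> complex" and C C' :: "'s \<Rightarrow> 'r::finite \<Rightarrow> complex"
  assumes "uniform_maximal_rank UNIV \<beta>" "j \<notin> B" "card B < CARD('d)"
  shows "extended_weight \<beta> C' (Inr j) \<notin> fun_space.span (extended_weight \<beta> C ` (range Inl \<union> Inr ` B))"
proof
  let ?res = "\<lambda>f :: complex ^ ('r + 'd) \<Rightarrow> complex. f \<circ> zero_extension"
  have Inl: "?res (extended_weight \<beta> D (Inl l)) = 0" for D l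
    by (simp add: fun_eq_iff extended_weight_simps coordinate_def)
  \<comment> \<open>The restriction forgets the matrix, so the tested weight may use
    \<open>C'\<close> while the span uses \<open>C\<close>.\<close>
  have Inr: "?res (extended_weight \<beta> D (Inr i)) = \<beta> i" for D i
    by (simp add: fun_eq_iff extended_weight_simps)
  assume "extended_weight \<beta> C' (Inr j) \<in> fun_space.span (extended_weight \<beta> C ` (range Inl \<union> Inr ` B))"
  then have "\<beta> j \<in> fun_space.span (?res ` (extended_weight \<beta> C ` (range Inl \<union> Inr ` B)))"
    using span_comp[of _ _ zero_extension] Inr[of C' j] by fastforce
  also have "\<dots> \<subseteq> fun_space.span (\<beta> ` B)"
  proof (rule fun_space.span_minimal)
    show "?res ` (extended_weight \<beta> C ` (range Inl \<union> Inr ` B)) \<subseteq> fun_space.span (\<beta> ` B)"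
      using fun_space.span_superset[of "\<beta> ` B"]
      by (auto simp only: Inl Inr fun_space.span_zero elim!: imageE UnE)
  qed (rule fun_space.subspace_span)
  finally show False
    using uniform_maximal_rank_notin_span[OF assms(1), of j B] assms by simp
qed

lemma inj_on_independent_insert:
  assumes "inj_on f K \<and> fun_space.independent (f ` K)" "f a \<notin> fun_space.span (f ` K)"
  shows "inj_on f (insert a K) \<and> fun_space.independent (f ` insert a K)"
proof -
  have "f a \<notin> f ` K" using assms(2) fun_space.span_superset[of "f ` K"] by auto
  with assms show ?thesis by (auto simp: fun_space.independent_insert)
qed

text \<open>Residual weights are added to the support coordinates one at a time; up to
  \<open>CARD('d)\<close> of them stay independent whatever the matrix is.\<close>

lemma extended_weight_independent_small:
  fixes \<beta> :: "'s::finite \<Rightarrow> complex ^ 'd \<Rightarrow> complex" and C :: "'s \<Rightarrow> 'r::finite \<Rightarrow> complex"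
  assumes "uniform_maximal_rank UNIV \<beta>" "card B \<le> CARD('d)"
  shows "inj_on (extended_weight \<beta> C) (range Inl \<union> Inr ` B) \<and>
    fun_space.independent (extended_weight \<beta> C ` (range Inl \<union> Inr ` B))"
proof -
  have "finite B" by simp
  then show ?thesis
    using assms(2)
  proof induction
    case empty
    have "extended_weight \<beta> C ` range Inl = coordinate ` range Inl"
      by (simp add: image_image extended_weight_simps)
    moreover have "inj_on (extended_weight \<beta> C) (range Inl)"
      using coordinate_independent[where 'k = "'r + 'd" and A = UNIV]
      by (auto intro!: inj_onI simp: extended_weight_simps inj_eq)
    moreover have "fun_space.independent (coordinate ` range (Inl :: 'r \<Rightarrow> 'r + 'd))"
      by (rule conjunct2[OF coordinate_independent])
    ultimately show ?case by (simp only: image_empty Un_empty_right simp_thms)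
  next
    case (insert j B)
    let ?K = "range Inl \<union> Inr ` B"
    have "extended_weight \<beta> C (Inr j) \<notin> fun_space.span (extended_weight \<beta> C ` ?K)"
      using insert.hyps insert.prems by (intro extended_weight_notin_span[OF assms(1)]) simp_all
    moreover have "card B \<le> CARD('d)" using insert.hyps insert.prems by simp
    then have "inj_on (extended_weight \<beta> C) ?K \<and> fun_space.independent (extended_weight \<beta> C ` ?K)"
      by (rule insert.IH)
    moreover have "range Inl \<union> Inr ` insert j B = insert (Inr j) ?K" by simp
    ultimately show ?case using inj_on_independent_insert by metis
  qed
qed

text \<open>
  If \<open>K\<close> contains fewer than \<open>d\<close> of the indices \<open>Inr i\<close>, restriction to \<open>\<complex>\<^sup>d\<close> decides. Otherwise
  \<open>W\<close>, if it contained the coordinates of \<open>\<complex>\<^sup>r\<close>, would be the whole dual space, of dimension \<open>r + d\<close>.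
\<close>

lemma extended_weight_avoidable:
  fixes \<beta> :: "'s::finite \<Rightarrow> complex ^ 'd \<Rightarrow> complex" and C :: "'s \<Rightarrow> 'r::finite \<Rightarrow> complex"
  assumes "uniform_maximal_rank UNIV \<beta>" "Inr j \<notin> K" "card K < CARD('r) + CARD('d)"
    and W: "W = fun_space.span (extended_weight \<beta> C ` K)"
  shows "\<not> (extended_weight \<beta> C' (Inr j) \<in> W \<and> range (\<lambda>l. coordinate (Inl l)) \<subseteq> W)"
proof
  assume *: "extended_weight \<beta> C' (Inr j) \<in> W \<and> range (\<lambda>l. coordinate (Inl l)) \<subseteq> W"
  define B where "B = Inr -` K"
  show False
  proof (cases "card B < CARD('d)")
    case True
    have "K \<subseteq> range Inl \<union> Inr ` B"
    proof
      fix k assume "k \<in> K"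
      then show "k \<in> range Inl \<union> Inr ` B" by (cases k) (auto simp: B_def)
    qed
    then have "W \<subseteq> fun_space.span (extended_weight \<beta> C ` (range Inl \<union> Inr ` B))"
      unfolding W by (intro fun_space.span_mono image_mono)
    moreover have "j \<notin> B" using assms(2) by (simp add: B_def)
    ultimately show False
      using * extended_weight_notin_span[OF assms(1) _ True, of j C' C] by blast
  next
    case False
    then obtain B' where B': "B' \<subseteq> B" "card B' = CARD('d)"
      by (meson not_less obtain_subset_with_card_n)
    let ?K = "range Inl \<union> Inr ` B' :: ('r + 's) set"
    have ind: "inj_on (extended_weight \<beta> C) ?K \<and>
        fun_space.independent (extended_weight \<beta> C ` ?K)"
      using assms(1) B'(2) by (intro extended_weight_independent_small) simp_all
    have sub: "extended_weight \<beta> C ` ?K \<subseteq> fun_space.span (extended_weight \<beta> C ` K)"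
    proof (rule image_subsetI)
      fix k :: "'r + 's" assume "k \<in> ?K"
      then consider l where "k = Inl l" | i where "k = Inr i" "i \<in> B'" by auto
      then show "extended_weight \<beta> C k \<in> fun_space.span (extended_weight \<beta> C ` K)"
      proof cases
        case 1
        with * show ?thesis by (auto simp: W extended_weight_simps(1))
      next
        case 2
        with B'(1) have "k \<in> K" by (auto simp: B_def)
        then show ?thesis by (intro fun_space.span_base imageI)
      qed
    qed
    \<comment> \<open>Counting: the weights of \<open>?K\<close> are independent and lie in the span
      of the fewer weights of \<open>K\<close>.\<close>
    have "CARD('r) + CARD('d) = card ?K"
      using B' by (subst card_Un_disjoint) (auto simp: card_image)
    also have "\<dots> = card (extended_weight \<beta> C ` ?K)"
      using ind by (intro card_image[symmetric]) simp
    also have "\<dots> \<le> card (extended_weight \<beta> C ` K)"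
      using ind sub by (intro conjunct2[OF fun_space.independent_span_bound]) simp_all
    also have "\<dots> \<le> card K" by (simp add: card_image_le)
    finally show False using assms(3) by simp
  qed
qed

text \<open>The rows of \<open>m\<close> are chosen one index \<open>j\<close> at a time. Row
  \<open>j\<close> has to avoid only the spans of smaller families formed from the support and the
  rows chosen before.\<close>

lemma exists_nat_shift_independent:
  fixes \<beta> :: "'s::finite \<Rightarrow> complex ^ 'd \<Rightarrow> complex" and c :: "'s \<Rightarrow> 'r::finite \<Rightarrow> complex"
    and b :: "'s \<Rightarrow> 'r \<Rightarrow> nat"
  assumes umr: "uniform_maximal_rank UNIV \<beta>"
  shows "\<exists>m :: 's \<Rightarrow> 'r \<Rightarrow> nat. (\<forall>j l. b j l \<le> m j l) \<and>
    (\<forall>K \<subseteq> range Inl \<union> Inr ` F. card K \<le> CARD('r) + CARD('d) \<longrightarrow>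
      inj_on (extended_weight \<beta> (\<lambda>j l. c j l + of_nat (m j l))) K \<and>
      fun_space.independent (extended_weight \<beta> (\<lambda>j l. c j l + of_nat (m j l)) ` K))"
    (is "\<exists>m. _ \<and> ?P m F")
proof -
  let ?L = "\<lambda>m. extended_weight \<beta> (\<lambda>j l. c j l + of_nat (m j l))"
  have "finite F" by simp
  then show ?thesis
  proof induction
    case empty
    \<comment> \<open>Only support coordinates occur here, so the lower bound itself is an
      admissible start.\<close>
    have "?P b {}"
    proof (intro allI impI)
      fix K :: "('r + 's) set"
      assume "K \<subseteq> range Inl \<union> Inr ` {}"
      then show "inj_on (?L b) K \<and> fun_space.independent (?L b ` K)"
        using extended_weight_independent_small[OF umr, of "{}" "\<lambda>j l. c j l + of_nat (b j l)"]
          inj_on_subset[of "?L b" "range Inl" K]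
          fun_space.independent_mono[of "?L b ` range Inl" "?L b ` K"]
        by auto
    qed
    then show ?case by (intro exI[of _ b]) simp
  next
    case (insert j F)
    then obtain m where m: "\<forall>j l. b j l \<le> m j l" "?P m F"
      by (elim exE conjE)
    define \<W> where "\<W> = (\<lambda>K. fun_space.span (?L m ` K)) `
      {K. K \<subseteq> range Inl \<union> Inr ` F \<and> card K < CARD('r) + CARD('d)}"
    have "\<exists>p. (\<forall>l\<in>UNIV. b j l \<le> p l) \<and> (\<forall>W\<in>\<W>. extended_weight \<beta> c (Inr j) +
        (\<Sum>l\<in>UNIV. fscale (of_nat (p l)) (coordinate (Inl l))) \<notin> W)"
    proof (rule avoid_subspaces)
      show "finite (UNIV :: 'r set)" "finite \<W>" by (simp_all add: \<W>_def)
      fix W assume "W \<in> \<W>"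
      then obtain K where K: "K \<subseteq> range Inl \<union> Inr ` F" "card K < CARD('r) + CARD('d)"
        and W: "W = fun_space.span (?L m ` K)"
        by (auto simp: \<W>_def)
      show "fun_space.subspace W" by (simp add: W)
      have "Inr j \<notin> K" using K(1) insert.hyps(2) by auto
      then show "\<not> (extended_weight \<beta> c (Inr j) \<in> W \<and> range (\<lambda>l. coordinate (Inl l)) \<subseteq> W)"
        using umr K(2) W by (intro extended_weight_avoidable)
    qed
    then obtain p where p: "(\<forall>l\<in>UNIV. b j l \<le> p l) \<and> (\<forall>W\<in>\<W>. extended_weight \<beta> c (Inr j) +
        (\<Sum>l\<in>UNIV. fscale (of_nat (p l)) (coordinate (Inl l))) \<notin> W)" ..
    define m' where "m' = m(j := p)"
    \<comment> \<open>Replacing row \<open>j\<close> leaves all other weights alone, so the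
      independence already obtained and the spans in \<open>\<W>\<close> survive.\<close>
    have L_other: "?L m' k = ?L m k" if "k \<noteq> Inr j" for k
      using that by (cases k) (auto simp: extended_weight_simps m'_def)
    have "?L m' (Inr j) = extended_weight \<beta> c (Inr j) +
        (\<Sum>l\<in>UNIV. fscale (of_nat (p l)) (coordinate (Inl l)))"
      by (simp only: extended_weight_add) (simp add: m'_def)
    with p have L_j: "?L m' (Inr j) \<notin> W" if "W \<in> \<W>" for W
      using that by simp
    have "?P m' (insert j F)"
    proof (intro allI impI)
      fix K :: "('r + 's) set"
      assume K: "K \<subseteq> range Inl \<union> Inr ` insert j F" "card K \<le> CARD('r) + CARD('d)"
      define K' where "K' = K - {Inr j}"
      have K': "K' \<subseteq> range Inl \<union> Inr ` F" using K(1) by (auto simp: K'_def)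
      have "card K' \<le> card K" by (simp add: K'_def card_mono)
      then have "inj_on (?L m) K' \<and> fun_space.independent (?L m ` K')"
        using m(2) K' K(2) by simp
      moreover have "inj_on (?L m) K' \<longleftrightarrow> inj_on (?L m') K'"
        by (rule inj_on_cong) (auto simp: K'_def L_other)
      moreover have img: "?L m ` K' = ?L m' ` K'"
        by (rule image_cong) (auto simp: K'_def L_other)
      ultimately have ind: "inj_on (?L m') K' \<and> fun_space.independent (?L m' ` K')" by simp
      show "inj_on (?L m') K \<and> fun_space.independent (?L m' ` K)"
      proof (cases "Inr j \<in> K")
        case False
        then have "K' = K" by (simp add: K'_def)
        with ind show ?thesis by simp
      next
        case True
        then have "K = insert (Inr j) K'" "Inr j \<notin> K'" by (auto simp: K'_def)
        moreover have "card K' < CARD('r) + CARD('d)"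
          using True K(2) by (metis K'_def card_Diff1_less finite order_less_le_trans)
        with K' have "fun_space.span (?L m ` K') \<in> \<W>"
          unfolding \<W>_def by (intro image_eqI[of _ _ K'] refl) simp
        then have "?L m' (Inr j) \<notin> fun_space.span (?L m' ` K')" unfolding img by (rule L_j)
        ultimately show ?thesis using inj_on_independent_insert[OF ind] by (simp only:)
      qed
    qed
    moreover have "\<forall>j l. b j l \<le> m' j l" using m(1) p by (simp add: m'_def)
    ultimately show ?case by (intro exI[of _ m'] conjI)
  qed
qed

section \<open>The isotropy of the support\<close>

lemma isotropy_extended_weight:
  fixes C :: "'s \<Rightarrow> 'r::finite \<Rightarrow> complex" and \<beta> :: "'s \<Rightarrow> complex ^ 'd \<Rightarrow> complex"
  shows "isotropy (extended_weight \<beta> C) (range Inl) = range zero_extension"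
proof
  show "range zero_extension \<subseteq> isotropy (extended_weight \<beta> C) (range Inl)"
    by (auto simp: isotropy_def extended_weight_simps coordinate_def)
  show "isotropy (extended_weight \<beta> C) (range Inl) \<subseteq> range zero_extension"
  proof
    fix t :: "complex ^ ('r + 'd)"
    assume "t \<in> isotropy (extended_weight \<beta> C) (range Inl)"
    then have "t $ Inl l = 0" for l
      by (auto simp: isotropy_def extended_weight_simps coordinate_def)
    then have "t $ k = zero_extension (\<chi> i. t $ Inr i) $ k" for k
      by (cases k) simp_all
    then have "t = zero_extension (\<chi> i. t $ Inr i)" unfolding vec_eq_iff by (rule allI)
    then show "t \<in> range zero_extension" by (rule image_eqI) simp
  qed
qed

lemma zero_extension_linear:
  "Vector_Spaces.linear (*s) (*s) (zero_extension :: complex ^ 'd \<Rightarrow> complex ^ ('r::finite + 'd))"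
proof -
  have add: "zero_extension (x + y) $ k = (zero_extension x + zero_extension y) $ k"
    and scale: "zero_extension (c *s x) $ k = (c *s zero_extension x) $ k"
    for x y :: "complex ^ 'd" and c and k :: "'r + 'd"
    by (cases k; simp)+
  have "(zero_extension (x + y) :: complex ^ ('r + 'd)) = zero_extension x + zero_extension y"
    "(zero_extension (c *s x) :: complex ^ ('r + 'd)) = c *s zero_extension x"
    for x y :: "complex ^ 'd" and c
    unfolding vec_eq_iff using add scale by (blast, blast)
  then show ?thesis
    by (simp add: Vector_Spaces.linear_iff vec.vector_space_axioms)
qed

lemma inj_zero_extension: "inj (zero_extension :: complex ^ 'a \<Rightarrow> complex ^ ('b::finite + 'a))"
proof (rule injI)
  fix x y :: "complex ^ 'a"
  assume eq: "zero_extension x = (zero_extension y :: complex ^ ('b + 'a))"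
  have "x $ i = y $ i" for i
    using arg_cong[OF eq, of "\<lambda>z. z $ Inr i"] by (simp only: zero_extension_nth)
  then show "x = y" by (simp add: vec_eq_iff)
qed

subsection \<open>Periods and monodromy\<close>

lemma subgroup_relation_lattice: "subgroup (relation_lattice H J \<beta>) additive_group"
  unfolding relation_lattice_def
  by (rule group.generate_is_subgroup[OF group_additive_group]) simp

text \<open>The relation is additive in \<open>\<alpha>\<close>, so it passes from the monoid to the
  group it generates. This is what lets the exponent of the monodromy descend to the quotient by the
  isotropy.\<close>

lemma relation_lattice_vanishes:
  assumes "\<alpha> \<in> relation_lattice H J \<beta>" "v \<in> H"
  shows "(\<Sum>j\<in>J. of_int (\<alpha> j) * \<beta> j v) = 0"
  using assms(1) unfolding relation_lattice_def
proof (induction rule: generate.induct)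
  case one
  then show ?case by simp
next
  case (incl h)
  then show ?case using assms(2) by (auto simp: relation_monoid_def)
next
  case (inv h)
  then show ?case using assms(2) by (auto simp: relation_monoid_def sum_negf)
next
  case (eng h1 h2)
  then show ?case by (simp add: distrib_right sum.distrib)
qed

lemma relation_monoid_reindex:
  assumes "residual_weights_via N \<Lambda> I \<phi> \<sigma> \<beta>" "\<rho> \<in> relation_monoid (isotropy \<Lambda> I) (N - I) \<Lambda>"
  shows "\<rho> \<circ> \<sigma> \<in> relation_monoid UNIV UNIV \<beta>"
proof -
  have \<sigma>: "bij_betw \<sigma> UNIV (N - I)" and \<phi>: "\<And>v. \<phi> v \<in> isotropy \<Lambda> I"
    and \<beta>: "\<And>j v. \<beta> j v = \<Lambda> (\<sigma> j) (\<phi> v)"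
    using assms(1) by (auto simp: residual_weights_via_def bij_betw_def)
  have "(\<Sum>j\<in>UNIV. of_nat (\<rho> (\<sigma> j)) * \<beta> j v) = 0" for v
  proof -
    have "(\<Sum>j\<in>UNIV. of_nat (\<rho> (\<sigma> j)) * \<beta> j v) = (\<Sum>i\<in>N - I. of_nat (\<rho> i) * \<Lambda> i (\<phi> v))"
      unfolding \<beta> by (rule sum.reindex_bij_betw[OF \<sigma>])
    also have "\<dots> = 0" using assms(2) \<phi> by (simp add: relation_monoid_def)
    finally show ?thesis .
  qed
  then show ?thesis by (simp add: relation_monoid_def)
qed

text \<open>Relabelling is additive and respects the generating monoids by
  \<open>relation_monoid_reindex\<close>. It follows that the characters \<open>\<eta> m\<close> are
  evaluated inside their domain.\<close>

lemma residual_lattice_reindex: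
  assumes "residual_weights_via N \<Lambda> I \<phi> \<sigma> \<beta>" "\<alpha> \<in> residual_lattice N \<Lambda> I"
  shows "\<alpha> \<circ> \<sigma> \<in> relation_lattice UNIV UNIV \<beta>"
  using assms(2) unfolding residual_lattice_def relation_lattice_def
proof (induction rule: generate.induct)
  case one
  have "0 \<circ> \<sigma> = (0 :: _ \<Rightarrow> int)" by (simp add: fun_eq_iff)
  then show ?case using generate.one[of additive_group] by (simp only: additive_group_simps)
next
  case (incl h)
  then obtain \<rho> where \<rho>: "\<rho> \<in> relation_monoid (isotropy \<Lambda> I) (N - I) \<Lambda>" "h = (\<lambda>j. int (\<rho> j))"
    by auto
  have "h \<circ> \<sigma> = (\<lambda>j. int ((\<rho> \<circ> \<sigma>) j))" by (simp add: \<rho>(2) fun_eq_iff)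
  then have "h \<circ> \<sigma> \<in> (\<lambda>\<alpha> j. int (\<alpha> j)) ` relation_monoid UNIV UNIV \<beta>"
    using relation_monoid_reindex[OF assms(1) \<rho>(1)] by (rule image_eqI)
  then show ?case by (rule generate.incl)
next
  case (inv h)
  then obtain \<rho> where \<rho>: "\<rho> \<in> relation_monoid (isotropy \<Lambda> I) (N - I) \<Lambda>" "h = (\<lambda>j. int (\<rho> j))"
    by auto
  have "h \<circ> \<sigma> = (\<lambda>j. int ((\<rho> \<circ> \<sigma>) j))" by (simp add: \<rho>(2) fun_eq_iff)
  then have "h \<circ> \<sigma> \<in> (\<lambda>\<alpha> j. int (\<alpha> j)) ` relation_monoid UNIV UNIV \<beta>"
    using relation_monoid_reindex[OF assms(1) \<rho>(1)] by (rule image_eqI)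
  then have "inv\<^bsub>additive_group\<^esub> (h \<circ> \<sigma>) \<in>
      generate additive_group ((\<lambda>\<alpha> j. int (\<alpha> j)) ` relation_monoid UNIV UNIV \<beta>)"
    by (rule generate.inv)
  moreover have "(- h) \<circ> \<sigma> = - (h \<circ> \<sigma>)" by (simp add: fun_eq_iff)
  ultimately show ?case by (simp only: inv_additive_group)
next
  case (eng h1 h2)
  have "(h1 + h2) \<circ> \<sigma> = (h1 \<circ> \<sigma>) + (h2 \<circ> \<sigma>)" by (simp add: fun_eq_iff)
  with generate.eng[OF eng.IH] show ?case by (simp only: additive_group_simps)
qed

section \<open>Periods, their integer coordinates and the quotient by the isotropy\<close>

lemma period_integer_unique:
  "2 * of_real pi * \<i> * of_int m = 2 * of_real pi * \<i> * (of_int m' :: complex) \<longleftrightarrow> m = m'"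
  by simp

text \<open>The preimage of the period group in the full space, before dividing by the
  isotropy.\<close>

definition periods :: "('i \<Rightarrow> complex ^ 'k \<Rightarrow> complex) \<Rightarrow> 'i set \<Rightarrow> (complex ^ 'k) set" where
  "periods \<Lambda> I = {t. \<forall>i\<in>I. \<exists>m::int. \<Lambda> i t = 2 * of_real pi * \<i> * of_int m}"

lemma period_group_carrierE:
  assumes "\<gamma> \<in> carrier (period_group \<Lambda> I)"
  obtains t where "t \<in> periods \<Lambda> I" "\<gamma> = (\<lambda>h. h + t) ` isotropy \<Lambda> I"
  using assms
  unfolding period_group_def periods_def FactGroup_def RCOSETS_def r_coset_def additive_group_def
  by auto

text \<open>A function constant on the coset has a singleton image, from which
  \<open>the_elem\<close> reads the value.\<close>

lemma quotient_eval_coset: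
  assumes "0 \<in> H" "\<And>h. h \<in> H \<Longrightarrow> f (h + t) = f t"
  shows "quotient_eval f ((\<lambda>h. h + t) ` H) = f (t :: 'a::monoid_add)"
proof -
  have "f ` (\<lambda>h. h + t) ` H = {f t}" using assms by (force simp: image_iff)
  then show ?thesis by (simp add: quotient_eval_def)
qed

lemma zero_in_isotropy:
  assumes "\<And>i. i \<in> I \<Longrightarrow> \<Lambda> i \<in> dual_space"
  shows "0 \<in> isotropy \<Lambda> I"
proof -
  have "\<Lambda> i (0 *s 0) = 0 * \<Lambda> i 0" if "i \<in> I" for i
    using assms[OF that] dual_space_iff by blast
  then show ?thesis by (simp add: isotropy_def)
qed

lemma standard_identification_coset:
  assumes "\<And>i. i \<in> I \<Longrightarrow> \<Lambda> i \<in> dual_space" "range \<tau> \<subseteq> I" "t \<in> periods \<Lambda> I"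
  shows "\<Lambda> (\<tau> l) t = 2 * of_real pi * \<i> *
    of_int (standard_identification \<Lambda> \<tau> ((\<lambda>h. h + t) ` isotropy \<Lambda> I) $ l)"
proof -
  have \<tau>: "\<tau> l \<in> I" using assms(2) by auto
  then obtain m :: int where m: "\<Lambda> (\<tau> l) t = 2 * of_real pi * \<i> * of_int m"
    using assms(3) unfolding periods_def by blast
  have "\<Lambda> (\<tau> l) (h + t) = \<Lambda> (\<tau> l) t" if "h \<in> isotropy \<Lambda> I" for h
  proof -
    have "\<Lambda> (\<tau> l) (h + t) = \<Lambda> (\<tau> l) h + \<Lambda> (\<tau> l) t"
      using assms(1)[OF \<tau>] dual_space_iff by blast
    then show ?thesis using that \<tau> by (simp add: isotropy_def)
  qed
  then have "quotient_eval (\<Lambda> (\<tau> l)) ((\<lambda>h. h + t) ` isotropy \<Lambda> I) = \<Lambda> (\<tau> l) t"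
    using zero_in_isotropy[OF assms(1)] by (intro quotient_eval_coset)
  then have "standard_identification \<Lambda> \<tau> ((\<lambda>h. h + t) ` isotropy \<Lambda> I) $ l =
      (THE m'. \<Lambda> (\<tau> l) t = 2 * of_real pi * \<i> * of_int m')"
    by (simp add: standard_identification_def)
  also have "\<dots> = m" unfolding m period_integer_unique by (rule the_equality) simp_all
  finally show ?thesis using m by simp
qed

text \<open>The first isomorphism theorem yields a map that is known to agree with
  \<open>standard_identification\<close> only on the carrier.\<close>

lemma iso_cong:
  assumes "group G" and f: "f \<in> iso G H" and eq: "\<And>x. x \<in> carrier G \<Longrightarrow> f x = g x"
  shows "g \<in> iso G H"
proof -
  interpret group G by fact
  have hom: "f \<in> hom G H" using f by (simp add: iso_def)
  have "g \<in> hom G H"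
  proof (rule homI)
    show "g x \<in> carrier H" if "x \<in> carrier G" for x
      using hom_in_carrier[OF hom that] eq[OF that] by simp
    show "g (x \<otimes>\<^bsub>G\<^esub> y) = g x \<otimes>\<^bsub>H\<^esub> g y" if "x \<in> carrier G" "y \<in> carrier G" for x y
      using hom_mult[OF hom that] eq[OF that(1)] eq[OF that(2)] eq[OF m_closed[OF that]] by simp
  qed
  moreover have "bij_betw g (carrier G) (carrier H)"
    using f bij_betw_cong[of "carrier G" f g] eq by (simp add: iso_def)
  ultimately show ?thesis by (simp add: iso_def)
qed

text \<open>First isomorphism theorem for the map sending a period to its integer coordinates, whose
  kernel is the isotropy. The assumption \<open>surj\<close> expresses linear independence of the
  support weights.\<close>

lemma standard_identification_iso:
  fixes \<Lambda> :: "'i \<Rightarrow> complex ^ 'k \<Rightarrow> complex" and \<tau> :: "'r::finite \<Rightarrow> 'i"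
  assumes dual: "\<And>i. i \<in> I \<Longrightarrow> \<Lambda> i \<in> dual_space" and \<tau>: "bij_betw \<tau> UNIV I"
    and surj: "\<And>z. \<exists>t. \<forall>l. \<Lambda> (\<tau> l) t = z l"
  shows "standard_identification \<Lambda> \<tau> \<in> iso (period_group \<Lambda> I) additive_group"
proof -
  let ?P = "periods \<Lambda> I"
  let ?G = "additive_group\<lparr>carrier := ?P\<rparr>"
  let ?coset = "\<lambda>t. (\<lambda>h. h + t) ` isotropy \<Lambda> I"
  let ?f = "\<lambda>t. standard_identification \<Lambda> \<tau> (?coset t)"
  have rng: "range \<tau> \<subseteq> I" and I: "I = range \<tau>" using \<tau> by (auto simp: bij_betw_def)
  have add: "\<Lambda> i (x + y) = \<Lambda> i x + \<Lambda> i y" if "i \<in> I" for i x y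
    using dual[OF that] dual_space_iff by blast
  have neg: "\<Lambda> i (- x) = - \<Lambda> i x" if "i \<in> I" for i x
  proof -
    have "\<Lambda> i ((-1) *s x) = (-1) * \<Lambda> i x" using dual[OF that] dual_space_iff by blast
    then show ?thesis by simp
  qed
  have f: "\<Lambda> (\<tau> l) t = 2 * of_real pi * \<i> * of_int (?f t $ l)" if "t \<in> ?P" for t l
    using dual rng that by (rule standard_identification_coset)
  have f_eqI: "?f t = m" if "t \<in> ?P" "\<And>l. \<Lambda> (\<tau> l) t = 2 * of_real pi * \<i> * of_int (m $ l)" for t m
    using f[OF that(1)] that(2) unfolding vec_eq_iff by (metis period_integer_unique)
  have memI: "t \<in> ?P" if "\<And>l. \<Lambda> (\<tau> l) t = 2 * of_real pi * \<i> * of_int (m l)" for t and m :: "'r \<Rightarrow> int"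
    using that unfolding periods_def I by blast
  have P_add: "x + y \<in> ?P" "?f (x + y) = ?f x + ?f y" if "x \<in> ?P" "y \<in> ?P" for x y
  proof -
    have *: "\<Lambda> (\<tau> l) (x + y) = 2 * of_real pi * \<i> * of_int ((?f x + ?f y) $ l)" for l
      using f[OF that(1), of l] f[OF that(2), of l] add[of "\<tau> l" x y] rng
      by (auto simp: distrib_left)
    then show "x + y \<in> ?P" by (rule memI)
    then show "?f (x + y) = ?f x + ?f y" using * by (rule f_eqI)
  qed
  have P_neg: "- x \<in> ?P" if "x \<in> ?P" for x
  proof (rule memI)
    show "\<Lambda> (\<tau> l) (- x) = 2 * of_real pi * \<i> * of_int (- (?f x $ l))" for l
      using f[OF that, of l] neg[of "\<tau> l" x] rng by auto
  qed
  have f_0: "x \<in> ?P \<and> ?f x = 0 \<longleftrightarrow> x \<in> isotropy \<Lambda> I" for x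
  proof
    assume x: "x \<in> ?P \<and> ?f x = 0"
    then have "\<Lambda> (\<tau> l) x = 0" for l using f[of x l] by simp
    then show "x \<in> isotropy \<Lambda> I" unfolding isotropy_def I by blast
  next
    assume "x \<in> isotropy \<Lambda> I"
    then have *: "\<Lambda> (\<tau> l) x = 2 * of_real pi * \<i> * of_int ((0 :: int ^ 'r) $ l)" for l
      using rng by (auto simp: isotropy_def)
    then have x: "x \<in> ?P" by (rule memI)
    moreover from x * have "?f x = 0" by (rule f_eqI)
    ultimately show "x \<in> ?P \<and> ?f x = 0" ..
  qed
  have P_0: "0 \<in> ?P" using f_0[THEN iffD2, OF zero_in_isotropy[OF dual]] by simp
  have "subgroup ?P additive_group"
    by (rule group.subgroupI[OF group_additive_group]) (use P_0 P_add P_neg in auto)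
  then have G: "group ?G" by (rule group.subgroup_imp_group[OF group_additive_group])
  have "?f \<in> hom ?G additive_group"
    using P_add(2) by (auto simp: hom_def)
  then interpret group_hom ?G additive_group ?f
    using G group_additive_group by (simp add: group_hom_def group_hom_axioms_def)
  have ker: "kernel ?G additive_group ?f = isotropy \<Lambda> I"
    using f_0 by (auto simp: kernel_def)
  have img: "?f ` carrier ?G = carrier additive_group"
  proof -
    have "m \<in> ?f ` ?P" for m
    proof -
      obtain t where t: "\<forall>l. \<Lambda> (\<tau> l) t = 2 * of_real pi * \<i> * of_int (m $ l)"
        using surj[of "\<lambda>l. 2 * of_real pi * \<i> * of_int (m $ l)"] by blast
      then have "t \<in> ?P" by (intro memI) blast
      with t f_eqI[of t m] show ?thesis by (metis image_eqI)
    qed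
    then show ?thesis by auto
  qed
  have pg: "period_group \<Lambda> I = ?G Mod isotropy \<Lambda> I"
    by (simp add: period_group_def periods_def)
  have iso: "(\<lambda>X. the_elem (?f ` X)) \<in> iso (period_group \<Lambda> I) additive_group"
    using FactGroup_iso_set[OF img] unfolding ker pg .
  \<comment> \<open>The induced map takes the common value of \<open>?f\<close> on a coset, and that
    value is the identification of the coset itself.\<close>
  have eq: "the_elem (?f ` \<gamma>) = standard_identification \<Lambda> \<tau> \<gamma>"
    if carrier: "\<gamma> \<in> carrier (period_group \<Lambda> I)" for \<gamma>
  proof -
    obtain t where t: "t \<in> ?P" and \<gamma>: "\<gamma> = ?coset t"
      using carrier by (rule period_group_carrierE)
    have "?f (h + t) = ?f t" if "h \<in> isotropy \<Lambda> I" for h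
      using P_add(2)[of h t] t f_0[of h] that by simp
    then have "quotient_eval ?f \<gamma> = ?f t"
      unfolding \<gamma> using zero_in_isotropy[OF dual] by (intro quotient_eval_coset)
    then show ?thesis by (simp add: quotient_eval_def \<gamma>)
  qed
  have "group (period_group \<Lambda> I)"
    using normal.factorgroup_is_group[OF normal_kernel] unfolding ker pg .
  then show ?thesis using iso eq by (rule iso_cong)
qed

text \<open>The exponent is additive and vanishes on the isotropy, hence is constant on the coset
  and can be computed at the representative \<open>t\<close>.\<close>

lemma envelope_monodromy_coset:
  assumes dual: "\<And>i. i \<in> N \<Longrightarrow> \<Lambda> i \<in> dual_space" and "I \<subseteq> N" and \<alpha>: "\<alpha> \<in> residual_lattice N \<Lambda> I"
  shows "envelope_monodromy N \<Lambda> I ((\<lambda>h. h + t) ` isotropy \<Lambda> I) \<alpha> =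
    exp (\<Sum>j\<in>N - I. of_int (\<alpha> j) * \<Lambda> j t)"
proof -
  let ?f = "\<lambda>t. \<Sum>j\<in>N - I. of_int (\<alpha> j) * \<Lambda> j t"
  have "?f (h + t) = ?f t" if "h \<in> isotropy \<Lambda> I" for h
  proof -
    have add: "\<Lambda> j (h + t) = \<Lambda> j h + \<Lambda> j t" if "j \<in> N - I" for j
      using dual[of j] that by (simp add: dual_space_iff)
    have "?f (h + t) = (\<Sum>j\<in>N - I. of_int (\<alpha> j) * \<Lambda> j h + of_int (\<alpha> j) * \<Lambda> j t)"
      by (intro sum.cong refl) (simp only: add distrib_left)
    then have "?f (h + t) = ?f h + ?f t" by (simp only: sum.distrib)
    moreover have "?f h = 0"
      using \<alpha> \<open>h \<in> isotropy \<Lambda> I\<close> unfolding residual_lattice_def by (rule relation_lattice_vanishes)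
    ultimately show ?thesis by simp
  qed
  moreover have "0 \<in> isotropy \<Lambda> I" by (rule zero_in_isotropy) (use dual assms(2) in blast)
  ultimately have "quotient_eval ?f ((\<lambda>h. h + t) ` isotropy \<Lambda> I) = ?f t"
    by (intro quotient_eval_coset[of _ ?f t])
  then show ?thesis using \<alpha> by (simp add: envelope_monodromy_def)
qed

subsection \<open>Realization of the monodromy\<close>

theorem theorem5p11:
  fixes \<beta> :: "'s::finite \<Rightarrow> complex ^ 'd \<Rightarrow> complex"
    and \<eta> :: "int ^ 'r \<Rightarrow> ('s \<Rightarrow> int) \<Rightarrow> complex"
  assumes "spanning_configuration UNIV \<beta>"
    and "uniform_maximal_rank UNIV \<beta>"
    and "\<eta> \<in> hom additive_group (character_group (relation_lattice UNIV UNIV \<beta>))"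
  shows "\<exists>(n::nat) (\<Lambda> :: nat \<Rightarrow> complex ^ ('r + 'd) \<Rightarrow> complex) I \<phi> \<sigma> (\<tau> :: 'r \<Rightarrow> nat).
     spanning_configuration {1..n} \<Lambda> \<and>
     uniform_maximal_rank {1..n} \<Lambda> \<and>
     Poincare_domain {1..n} \<Lambda> \<and>
     singular_support {1..n} \<Lambda> I \<and> card I = CARD('r) \<and>
     residual_weights_via {1..n} \<Lambda> I \<phi> \<sigma> \<beta> \<and>
     bij_betw \<tau> UNIV I \<and>
     standard_identification \<Lambda> \<tau> \<in> iso (period_group \<Lambda> I) additive_group \<and>
     (\<forall>\<gamma> \<in> carrier (period_group \<Lambda> I).
        \<forall>\<alpha> \<in> residual_lattice {1..n} \<Lambda> I.
          envelope_monodromy {1..n} \<Lambda> I \<gamma> \<alpha> =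
            \<eta> (standard_identification \<Lambda> \<tau> \<gamma>) (\<alpha> \<circ> \<sigma>))"
proof -
  have \<beta>_dual: "range \<beta> \<subseteq> dual_space"
    using assms(1) by (simp add: spanning_configuration_def)
  obtain c :: "'s \<Rightarrow> 'r \<Rightarrow> complex" where
    c: "\<forall>m. \<forall>\<alpha>\<in>relation_lattice UNIV UNIV \<beta>. \<eta> m \<alpha> = exp (2 * of_real pi * \<i> *
      (\<Sum>j\<in>UNIV. \<Sum>l\<in>UNIV. of_int (\<alpha> j) * c j l * of_int (m $ l)))"
    using character_log[OF subgroup_relation_lattice assms(3)] ..
  \<comment> \<open>With \<open>p j l\<close> at least this large, the real part of
    \<open>c j l + of_nat (p j l)\<close> is at least 1.\<close>
  define b where "b j l = nat \<lceil>\<bar>Re (c j l)\<bar> + 1\<rceil>" for j l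
  obtain p :: "'s \<Rightarrow> 'r \<Rightarrow> nat" where p: "(\<forall>j l. b j l \<le> p j l) \<and>
    (\<forall>K \<subseteq> range Inl \<union> Inr ` UNIV. card K \<le> CARD('r) + CARD('d) \<longrightarrow>
      inj_on (extended_weight \<beta> (\<lambda>j l. c j l + of_nat (p j l))) K \<and>
      fun_space.independent (extended_weight \<beta> (\<lambda>j l. c j l + of_nat (p j l)) ` K))"
    using exists_nat_shift_independent[OF assms(2), of b UNIV c] ..
  define L where "L = extended_weight \<beta> (\<lambda>j l. c j l + of_nat (p j l))"
  define n where "n = CARD('r + 's)"
  \<comment> \<open>A numbering of the sum type moves the construction to the index set
    \<open>{1..n}\<close>.\<close>
  obtain lab :: "'r + 's \<Rightarrow> nat" where lab: "bij_betw lab UNIV {1..n}"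
    using ex_bij_betw_finite_nat
    by (metis card_atLeastAtMost diff_Suc_1 finite finite_atLeastAtMost finite_same_card_bij n_def)
  have inj_lab: "inj lab" and img_lab: "range lab = {1..n}" using lab by (auto simp: bij_betw_def)
  define \<Lambda> where "\<Lambda> = L \<circ> inv_into UNIV lab"
  define \<tau> where "\<tau> = (\<lambda>l::'r. lab (Inl l))"
  define \<sigma> where "\<sigma> = (\<lambda>j::'s. lab (Inr j))"
  define I where "I = range \<tau>"
  have \<Lambda>_lab: "\<Lambda> (lab k) = L k" for k using inj_lab by (simp add: \<Lambda>_def inv_into_f_f)
  have \<Lambda>_\<tau>: "\<Lambda> (\<tau> l) = (\<lambda>t. t $ Inl l)" for l
    by (simp add: \<tau>_def \<Lambda>_lab L_def extended_weight_simps coordinate_def)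
  have \<Lambda>_\<sigma>: "\<Lambda> (\<sigma> j) = (\<lambda>t. (\<Sum>l\<in>UNIV. (c j l + of_nat (p j l)) * t $ Inl l) + \<beta> j (\<chi> i. t $ Inr i))" for j
    by (simp add: \<sigma>_def \<Lambda>_lab L_def extended_weight_simps)
  have dual: "\<Lambda> ` {1..n} \<subseteq> dual_space"
    unfolding img_lab[symmetric] using extended_weight_dual_space[OF \<beta>_dual] by (auto simp: \<Lambda>_lab L_def)
  have indep: "inj_on \<Lambda> K \<and> fun_space.independent (\<Lambda> ` K)"
    if K: "K \<subseteq> {1..n}" "card K \<le> CARD('r + 'd)" for K
  proof -
    define K' where "K' = lab -` K"
    have K_eq: "K = lab ` K'" using K(1) img_lab by (auto simp: K'_def)
    have "card K' = card K"
      unfolding K_eq using inj_lab by (simp add: card_image inj_on_subset[OF inj_lab])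
    moreover have "K' \<subseteq> range Inl \<union> range Inr" by (metis UNIV_sum subset_UNIV)
    ultimately have "inj_on L K' \<and> fun_space.independent (L ` K')"
      using p K(2) unfolding L_def by simp
    moreover have "inj_on \<Lambda> (lab ` K')" if "inj_on L K'"
      using that by (auto simp: inj_on_def \<Lambda>_lab)
    ultimately show ?thesis by (simp add: K_eq image_image \<Lambda>_lab)
  qed
  have I_sub: "I \<subseteq> {1..n}" unfolding I_def \<tau>_def using img_lab by auto
  have \<tau>_bij: "bij_betw \<tau> UNIV I"
    using inj_lab by (auto simp: bij_betw_def I_def \<tau>_def inj_def)
  have card_I: "card I = CARD('r)" using bij_betw_same_card[OF \<tau>_bij] by simp
  have "inj \<sigma>" using inj_lab by (auto simp: \<sigma>_def inj_def)
  moreover have "range \<sigma> = {1..n} - I"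
  proof -
    have "{1..n} = lab ` (range Inl \<union> range Inr)" using img_lab UNIV_sum by metis
    then have "{1..n} = I \<union> range \<sigma>" by (simp add: I_def \<sigma>_def \<tau>_def image_Un image_image)
    moreover have "I \<inter> range \<sigma> = {}"
      using inj_lab by (auto simp: I_def \<sigma>_def \<tau>_def inj_eq)
    ultimately show ?thesis by blast
  qed
  ultimately have \<sigma>_bij: "bij_betw \<sigma> UNIV ({1..n} - I)" by (simp add: bij_betw_def)
  have rank: "uniform_maximal_rank {1..n} \<Lambda>"
    using dual indep by (intro uniform_maximal_rankI) auto
  have spanning: "spanning_configuration {1..n} \<Lambda>"
  proof (rule spanning_configurationI[OF dual])
    \<comment> \<open>A spanning \<open>\<beta>\<close> has at least \<open>CARD('d)\<close>
      members.\<close>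
    show "CARD('r + 'd) \<le> card {1..n}"
      using card_ge_dim_of_spanning_configuration[OF assms(1)] by (simp add: n_def)
  qed (use indep in auto)
  have singular: "singular_support {1..n} \<Lambda> I"
  proof -
    have "fun_space.dim (fun_space.span (\<Lambda> ` I)) = min CARD('r) (CARD('r + 'd))"
      using rank I_sub card_I unfolding uniform_maximal_rank_def by metis
    \<comment> \<open>Strict because the dimension of the second factor is positive.\<close>
    also have "\<dots> < CARD('r + 'd)" by simp
    finally show ?thesis using I_sub unfolding singular_support_def by blast
  qed
  have poincare: "Poincare_domain {1..n} \<Lambda>"
  proof -
    define \<xi> :: "complex ^ ('r + 'd)" where "\<xi> = (\<chi> k. case k of Inl _ \<Rightarrow> 1 | Inr _ \<Rightarrow> 0)"
    have "0 < Re (\<Lambda> (lab k) \<xi>)" for k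
    proof (cases k)
      case (Inl l)
      have "\<Lambda> (lab k) = (\<lambda>t. t $ Inl l)" using \<Lambda>_\<tau>[of l] by (simp add: \<tau>_def Inl)
      then show ?thesis by (simp add: \<xi>_def)
    next
      case (Inr j)
      have pos: "0 < Re (c j l + of_nat (p j l))" for l
      proof -
        have "\<bar>Re (c j l)\<bar> + 1 \<le> of_nat (b j l)" unfolding b_def by linarith
        also have "\<dots> \<le> (of_nat (p j l) :: real)" using p by simp
        finally show ?thesis by simp
      qed
      have "\<beta> j 0 = 0"
      proof -
        have "\<beta> j (0 *s 0) = 0 * \<beta> j 0" using \<beta>_dual dual_space_iff by blast
        then show ?thesis by simp
      qed
      moreover have "(\<chi> i. \<xi> $ Inr i) = 0" by (simp add: \<xi>_def vec_eq_iff)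
      moreover have "\<xi> $ Inl l = 1" for l by (simp add: \<xi>_def)
      ultimately have "\<Lambda> (lab k) \<xi> = (\<Sum>l\<in>UNIV. c j l + of_nat (p j l))"
        using \<Lambda>_\<sigma>[of j] by (simp add: \<sigma>_def Inr)
      \<comment> \<open>The sum is nonempty since \<open>'r\<close> has an element, so positive
        terms give a positive value.\<close>
      moreover have "0 < (\<Sum>l\<in>UNIV. Re (c j l + of_nat (p j l)))"
        using pos by (intro sum_pos) simp_all
      ultimately show ?thesis by simp
    qed
    then show ?thesis unfolding Poincare_domain_def img_lab[symmetric] by blast
  qed
  have iso: "isotropy \<Lambda> I = range zero_extension"
  proof -
    have "isotropy \<Lambda> I = isotropy L (range Inl)"
      by (simp add: isotropy_def I_def \<tau>_def \<Lambda>_lab)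
    then show ?thesis by (simp add: L_def isotropy_extended_weight)
  qed
  have residual: "residual_weights_via {1..n} \<Lambda> I zero_extension \<sigma> \<beta>"
    unfolding residual_weights_via_def
    using zero_extension_linear inj_zero_extension iso \<sigma>_bij by (auto simp: bij_betw_def \<Lambda>_\<sigma>)
  have dual_I: "\<Lambda> i \<in> dual_space" if "i \<in> I" for i using dual I_sub that by blast
  have std: "standard_identification \<Lambda> \<tau> \<in> iso (period_group \<Lambda> I) additive_group"
  proof (rule standard_identification_iso[OF dual_I \<tau>_bij])
    show "\<exists>t. \<forall>l. \<Lambda> (\<tau> l) t = z l" for z
      by (rule exI[of _ "\<chi> k. case k of Inl l \<Rightarrow> z l | Inr _ \<Rightarrow> 0"]) (simp add: \<Lambda>_\<tau>)
  qed
  have "envelope_monodromy {1..n} \<Lambda> I \<gamma> \<alpha> = \<eta> (standard_identification \<Lambda> \<tau> \<gamma>) (\<alpha> \<circ> \<sigma>)"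
    if carrier: "\<gamma> \<in> carrier (period_group \<Lambda> I)" and \<alpha>: "\<alpha> \<in> residual_lattice {1..n} \<Lambda> I" for \<gamma> \<alpha>
  proof -
    obtain t where t: "t \<in> periods \<Lambda> I" and \<gamma>: "\<gamma> = (\<lambda>h. h + t) ` isotropy \<Lambda> I"
      using carrier by (rule period_group_carrierE)
    define m where "m = standard_identification \<Lambda> \<tau> \<gamma>"
    have m: "t $ Inl l = 2 * of_real pi * \<i> * of_int (m $ l)" for l
      using standard_identification_coset[OF dual_I _ t, of \<tau> l] unfolding m_def \<gamma> \<Lambda>_\<tau> I_def by simp
    have mem: "\<alpha> \<circ> \<sigma> \<in> relation_lattice UNIV UNIV \<beta>"
      using residual \<alpha> by (rule residual_lattice_reindex)
    let ?S = "\<lambda>C. \<Sum>j\<in>UNIV. \<Sum>l\<in>UNIV. of_int ((\<alpha> \<circ> \<sigma>) j) * C j l * of_int (m $ l) :: complex"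
    have "(\<Sum>i\<in>{1..n} - I. of_int (\<alpha> i) * \<Lambda> i t) = (\<Sum>j\<in>UNIV. of_int (\<alpha> (\<sigma> j)) * \<Lambda> (\<sigma> j) t)"
      by (rule sum.reindex_bij_betw[OF \<sigma>_bij, symmetric])
    also have "\<dots> = (\<Sum>j\<in>UNIV. of_int (\<alpha> (\<sigma> j)) * (\<Sum>l\<in>UNIV. (c j l + of_nat (p j l)) * t $ Inl l)) +
        (\<Sum>j\<in>UNIV. of_int ((\<alpha> \<circ> \<sigma>) j) * \<beta> j (\<chi> i. t $ Inr i))"
      by (simp add: \<Lambda>_\<sigma> distrib_left sum.distrib)
    \<comment> \<open>The second sum drops out because \<open>\<alpha> \<circ> \<sigma>\<close> is a
      relation among the \<open>\<beta> j\<close>; only the period coordinates of \<open>t\<close>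
      remain.\<close>
    also have "\<dots> = (\<Sum>j\<in>UNIV. of_int (\<alpha> (\<sigma> j)) * (\<Sum>l\<in>UNIV. (c j l + of_nat (p j l)) * t $ Inl l))"
      using relation_lattice_vanishes[OF mem UNIV_I] by simp
    also have "\<dots> = 2 * of_real pi * \<i> * ?S (\<lambda>j l. c j l + of_nat (p j l))"
      unfolding m sum_distrib_left by (intro sum.cong refl) (simp add: algebra_simps)
    finally have "envelope_monodromy {1..n} \<Lambda> I \<gamma> \<alpha> =
        exp (2 * of_real pi * \<i> * ?S (\<lambda>j l. c j l + of_nat (p j l)))"
      using envelope_monodromy_coset[OF _ I_sub \<alpha>, of t] dual by (simp add: \<gamma> image_subset_iff)
    also have "\<dots> = exp (2 * of_real pi * \<i> * ?S c)"
      by (rule exp_period_shift)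
    also have "\<dots> = \<eta> m (\<alpha> \<circ> \<sigma>)" using c mem by simp
    finally show ?thesis unfolding m_def .
  qed
  then show ?thesis
    using spanning rank poincare singular card_I residual \<tau>_bij std
    by (intro exI[of _ n] exI[of _ \<Lambda>] exI[of _ I] exI[of _ zero_extension] exI[of _ \<sigma>] exI[of _ \<tau>]) simp
qed

end
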